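(* Let $(\mathscr{H},d)$ be a Polish metric space of diameter at most $1$ and $b\in[0,1)$. Let $\{T_k=(V_k,E_k):k\in\mathbb{N}\}$ be a sequence of finite rooted trees, for each $k$ let $\nu_k\in\mathrm{Prob}(\mathscr{H}^{V_k})$ be a $b$-Lipschitz $\mathscr{H}$-valued Markov measure indexed by $T_k$, and let $\Delta_k=\Delta(T_k,b)$ be the $\ell^2(V_k)$-norm of the descendant generating function of $T_k$. Consider the sequence of metric probability spaces $\{(\mathscr{H}^{V_k},d,\nu_k):k\in\mathbb{N}\}$, with $d$ the normalized Hamming metric. Then: (1) if $\Delta_k=o(|V_k|)$ as $k\to\infty$, the sequence is a Lévy family; (2) if $|V_1|<|V_2|<\cdots$ and $\Delta_k=O(\sqrt{|V_k|})$, the sequence is a normal Lévy family.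
   Context: $\mathrm{Prob}(X)$ is the set of Borel probability measures on $X$. For a finite set $V$, the normalized Hamming metric on $\mathscr{H}^V$ is $d(x,y)=\frac1{|V|}\sum_{v\in V}d(x_v,y_v)$. On $\mathrm{Prob}(\mathscr{H})$, $\bar d(\mu,\nu)=\inf_\lambda\int d(x,y)\,d\lambda(x,y)$, the infimum being over couplings $\lambda$ of $\mu,\nu$. $\mathrm{Lip}_1(X,d)$ is the set of $1$-Lipschitz functions $X\to\mathbb{R}$. Lévy families: a sequence of metric probability spaces $(X_k,d_k,\mu_k)$ is a Lévy family if for every $\varepsilon>0$ \[\sup\Big\{\mu_k\{f>\varepsilon\}: f\in\mathrm{Lip}_1(X_k,d_k),\ \int f\,d\mu_k=0\Big\}\to0\quad\text{as }k\to\infty.\] If $X_k=\mathscr{H}^{n_k}$ with $1\le n_1<n_2<\cdots$ (here $n_k=|V_k|$), it is a normal Lévy family if there exist constants $c_1,c_2>0$ such that for all $\varepsilon>0$ and all $k$ this supremum is at most $c_1e^{-c_2n_k\varepsilon^2}$. Trees: for a tree $T=(V,E)$ with root $\rho$, $\pi(v)$ is the parent of a non-root vertex $v$; $d(v,w)$ is the graph distance; $v\le w$ means that $v$ lies on the simple path from $\rho$ to $w$ (endpoints included); $D_r(v)=\{w\in V: v\le w,\ d(v,w)=r\}$. Markov measure indexed by a finite rooted tree $T$: let $r$ be the depth of $T$ and $L_j$ the set of vertices at distance $j$ from $\rho$. Given $\nu_\rho\in\mathrm{Prob}(\mathscr{H})$ and probability kernels $q_v\colon\mathscr{H}\to\mathrm{Prob}(\mathscr{H})$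 for $v\in V\setminus\{\rho\}$, the associated Markov measure is the $\nu\in\mathrm{Prob}(\mathscr{H}^V)$ given by \[\nu(A)=\int_{\mathscr{H}^{L_0}}\int_{\mathscr{H}^{L_1}}\cdots\int_{\mathscr{H}^{L_r}}\mathbf 1_A(y)\prod_{v\in L_r}q_v(dy_v|y_{\pi(v)})\cdots\prod_{v\in L_1}q_v(dy_v|y_\rho)\,\nu_\rho(dy_\rho)\] for Borel $A\subseteq\mathscr{H}^V$. It is $b$-Lipschitz if each $q_v$ is $b$-Lipschitz as a map $(\mathscr{H},d)\to(\mathrm{Prob}(\mathscr{H}),\bar d)$. Descendant generating function: $\delta(v)=\sum_{r=0}^\infty|D_r(v)|\,b^r$ (with $b^0=1$, also when $b=0$), and $\Delta(T,b)=\big(\sum_{v\in V}\delta(v)^2\big)^{1/2}$. *)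

theory Defs
  imports "HOL-Probability.Probability" "HOL-Library.Landau_Symbols"
begin

section \<open>Metric probability spaces and concentration\<close>

definition metric_prob_space :: "'a set \<Rightarrow> ('a \<Rightarrow> 'a \<Rightarrow> real) \<Rightarrow> 'a measure \<Rightarrow> bool" where
  "metric_prob_space X d \<mu> \<longleftrightarrow>
     Metric_space X d \<and> prob_space \<mu> \<and> space \<mu> = X \<and>
     sets \<mu> = sigma_sets X {U. openin (Metric_space.mtopology X d) U}"

definition Lip1 :: "'a set \<Rightarrow> ('a \<Rightarrow> 'a \<Rightarrow> real) \<Rightarrow> ('a \<Rightarrow> real) set" where
  "Lip1 X d = {f. \<forall>x\<in>X. \<forall>y\<in>X. \<bar>f x - f y\<bar> \<le> d x y}"

text \<open>The explicit integrability requirement is there because the Bochner integral of a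
  non-integrable function is \<open>0\<close>.\<close>

definition concentration :: "'a set \<Rightarrow> ('a \<Rightarrow> 'a \<Rightarrow> real) \<Rightarrow> 'a measure \<Rightarrow> real \<Rightarrow> real" where
  "concentration X d \<mu> \<epsilon> =
     (SUP f \<in> {f \<in> Lip1 X d. integrable \<mu> f \<and> integral\<^sup>L \<mu> f = 0}. measure \<mu> {x \<in> X. f x > \<epsilon>})"

definition levy_family ::
  "(nat \<Rightarrow> 'a set) \<Rightarrow> (nat \<Rightarrow> 'a \<Rightarrow> 'a \<Rightarrow> real) \<Rightarrow> (nat \<Rightarrow> 'a measure) \<Rightarrow> bool" where
  "levy_family X d \<mu> \<longleftrightarrow>
     (\<forall>k. metric_prob_space (X k) (d k) (\<mu> k)) \<and>
     (\<forall>\<epsilon>>0. (\<lambda>k. concentration (X k) (d k) (\<mu> k) \<epsilon>) \<longlonglongrightarrow> 0)"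

definition normal_levy_family ::
  "(nat \<Rightarrow> 'v set) \<Rightarrow> (nat \<Rightarrow> ('v \<Rightarrow> 'h) \<Rightarrow> ('v \<Rightarrow> 'h) \<Rightarrow> real) \<Rightarrow> (nat \<Rightarrow> ('v \<Rightarrow> 'h) measure) \<Rightarrow> bool"
where
  "normal_levy_family V d \<mu> \<longleftrightarrow>
     (\<forall>k. metric_prob_space (V k \<rightarrow>\<^sub>E UNIV) (d k) (\<mu> k)) \<and>
     1 \<le> card (V 0) \<and> strict_mono (\<lambda>k. card (V k)) \<and>
     (\<exists>c1>0. \<exists>c2>0. \<forall>\<epsilon>>0. \<forall>k.
        concentration (V k \<rightarrow>\<^sub>E UNIV) (d k) (\<mu> k) \<epsilon> \<le> c1 * exp (- c2 * real (card (V k)) * \<epsilon>\<^sup>2))"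

definition hamming :: "'v set \<Rightarrow> ('v \<Rightarrow> 'h::metric_space) \<Rightarrow> ('v \<Rightarrow> 'h) \<Rightarrow> real" where
  "hamming V x y = (\<Sum>v\<in>V. dist (x v) (y v)) / real (card V)"


section \<open>The transport metric on probability measures\<close>

definition couplings :: "'h::metric_space measure \<Rightarrow> 'h measure \<Rightarrow> ('h \<times> 'h) measure set" where
  "couplings \<mu> \<nu> =
     {\<gamma> \<in> space (prob_algebra (borel \<Otimes>\<^sub>M borel)). distr \<gamma> borel fst = \<mu> \<and> distr \<gamma> borel snd = \<nu>}"

text \<open>On a space of finite diameter all the integrals below are those of bounded functions, and
  the product measure is a coupling of any two Borel probability measures.\<close>

definition dbar :: "'h::metric_space measure \<Rightarrow> 'h measure \<Rightarrow> real" where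
  "dbar \<mu> \<nu> = (INF \<gamma> \<in> couplings \<mu> \<nu>. integral\<^sup>L \<gamma> (\<lambda>(x, y). dist x y))"


section \<open>Finite rooted trees\<close>

record 'v rooted_graph =
  verts :: "'v set"
  edges :: "'v set set"
  root :: 'v

definition walk :: "'v rooted_graph \<Rightarrow> 'v \<Rightarrow> 'v list \<Rightarrow> 'v \<Rightarrow> bool" where
  "walk T u xs v \<longleftrightarrow>
     xs \<noteq> [] \<and> set xs \<subseteq> verts T \<and> successively (\<lambda>x y. {x, y} \<in> edges T) xs \<and> hd xs = u \<and> last xs = v"

definition simple_path :: "'v rooted_graph \<Rightarrow> 'v \<Rightarrow> 'v list \<Rightarrow> 'v \<Rightarrow> bool" where
  "simple_path T u xs v \<longleftrightarrow> walk T u xs v \<and> distinct xs"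

definition is_cycle :: "'v rooted_graph \<Rightarrow> 'v list \<Rightarrow> bool" where
  "is_cycle T xs \<longleftrightarrow> 3 \<le> length xs \<and> simple_path T (hd xs) xs (last xs) \<and> {last xs, hd xs} \<in> edges T"

definition finite_rooted_tree :: "'v rooted_graph \<Rightarrow> bool" where
  "finite_rooted_tree T \<longleftrightarrow>
     finite (verts T) \<and> root T \<in> verts T \<and>
     (\<forall>e\<in>edges T. \<exists>u\<in>verts T. \<exists>v\<in>verts T. u \<noteq> v \<and> e = {u, v}) \<and>
     (\<forall>u\<in>verts T. \<forall>v\<in>verts T. \<exists>xs. walk T u xs v) \<and>
     (\<nexists>xs. is_cycle T xs)"

text \<open>A walk with \<open>n\<close> edges is a list of \<open>n + 1\<close> vertices.\<close>

definition graph_dist :: "'v rooted_graph \<Rightarrow> 'v \<Rightarrow> 'v \<Rightarrow> nat" where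
  "graph_dist T u v = (LEAST n. \<exists>xs. walk T u xs v \<and> length xs = Suc n)"

definition tree_le :: "'v rooted_graph \<Rightarrow> 'v \<Rightarrow> 'v \<Rightarrow> bool" where
  "tree_le T v w \<longleftrightarrow> (\<exists>xs. simple_path T (root T) xs w \<and> v \<in> set xs)"

definition parent :: "'v rooted_graph \<Rightarrow> 'v \<Rightarrow> 'v" where
  "parent T v = (THE u. {u, v} \<in> edges T \<and> tree_le T u v)"

definition descendants_at :: "'v rooted_graph \<Rightarrow> nat \<Rightarrow> 'v \<Rightarrow> 'v set" where
  "descendants_at T r v = {w \<in> verts T. tree_le T v w \<and> graph_dist T v w = r}"

definition level :: "'v rooted_graph \<Rightarrow> nat \<Rightarrow> 'v set" where
  "level T j = {v \<in> verts T. graph_dist T (root T) v = j}"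

definition depth :: "'v rooted_graph \<Rightarrow> nat" where
  "depth T = Max (graph_dist T (root T) ` verts T)"

definition descendant_gf :: "'v rooted_graph \<Rightarrow> real \<Rightarrow> 'v \<Rightarrow> real" where
  "descendant_gf T b v = (\<Sum>r. real (card (descendants_at T r v)) * b ^ r)"

definition Delta :: "'v rooted_graph \<Rightarrow> real \<Rightarrow> real" where
  "Delta T b = sqrt (\<Sum>v\<in>verts T. (descendant_gf T b v)\<^sup>2)"


section \<open>Markov measures indexed by a finite rooted tree\<close>

text \<open>Configurations are the extensional functions \<open>verts T \<rightarrow>\<^sub>E UNIV\<close>, and their Borel
  \<open>\<sigma>\<close>-algebra is the product one because the state space is second countable. The following
  function integrates \<open>f\<close> successively over the values at the \<open>n\<close> levels \<open>j, \<dots>, j + n - 1\<close>,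
  given a configuration \<open>y\<close> on the levels \<open>0, \<dots>, j - 1\<close>; the level-\<open>j\<close> integral is the outermost.\<close>

primrec level_integrals :: "'v rooted_graph \<Rightarrow> ('v \<Rightarrow> 'h \<Rightarrow> 'h measure) \<Rightarrow> nat \<Rightarrow> nat \<Rightarrow>
    (('v \<Rightarrow> 'h) \<Rightarrow> ennreal) \<Rightarrow> ('v \<Rightarrow> 'h) \<Rightarrow> ennreal" where
  "level_integrals T q 0 j f y = f y"
| "level_integrals T q (Suc n) j f y =
     (\<integral>\<^sup>+ z. level_integrals T q n (Suc j) f (override_on y z (level T j))
        \<partial>(\<Pi>\<^sub>M v\<in>level T j. q v (y (parent T v))))"

definition markov_measure :: "'v rooted_graph \<Rightarrow> 'h::polish_space measure \<Rightarrow>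
    ('v \<Rightarrow> 'h \<Rightarrow> 'h measure) \<Rightarrow> ('v \<Rightarrow> 'h) measure \<Rightarrow> bool" where
  "markov_measure T \<nu>0 q \<nu> \<longleftrightarrow>
     \<nu>0 \<in> space (prob_algebra borel) \<and>
     (\<forall>v\<in>verts T - {root T}. q v \<in> borel \<rightarrow>\<^sub>M prob_algebra borel) \<and>
     \<nu> \<in> space (prob_algebra (\<Pi>\<^sub>M v\<in>verts T. borel)) \<and>
     (\<forall>A\<in>sets \<nu>. emeasure \<nu> A =
        (\<integral>\<^sup>+ t. level_integrals T q (depth T) 1 (indicator A) ((\<lambda>_. undefined)(root T := t)) \<partial>\<nu>0))"

definition lipschitz_markov_measure ::
  "'v rooted_graph \<Rightarrow> real \<Rightarrow> ('v \<Rightarrow> 'h::polish_space) measure \<Rightarrow> bool" where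
  "lipschitz_markov_measure T b \<nu> \<longleftrightarrow>
     (\<exists>\<nu>0 q. markov_measure T \<nu>0 q \<nu> \<and>
        (\<forall>v\<in>verts T - {root T}. \<forall>x y. dbar (q v x) (q v y) \<le> b * dist x y))"


section \<open>Product spaces with the Hamming metric are metric probability spaces\<close>

lemma Metric_space_hamming:
  fixes V :: "'v set"
  assumes "finite V"
  shows "Metric_space (V \<rightarrow>\<^sub>E (UNIV :: 'h::metric_space set)) (hamming V)"
proof
  fix x y z :: "'v \<Rightarrow> 'h"
  show "0 \<le> hamming V x y"
    by (simp add: hamming_def sum_nonneg)
  show "hamming V x y = hamming V y x"
    by (simp add: hamming_def dist_commute)
  have "(\<Sum>v\<in>V. dist (x v) (z v)) \<le> (\<Sum>v\<in>V. dist (x v) (y v)) + (\<Sum>v\<in>V. dist (y v) (z v))"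
    unfolding sum.distrib[symmetric] by (intro sum_mono dist_triangle)
  then show "hamming V x z \<le> hamming V x y + hamming V y z"
    unfolding hamming_def add_divide_distrib[symmetric] by (intro divide_right_mono) auto
  assume "x \<in> V \<rightarrow>\<^sub>E UNIV" "y \<in> V \<rightarrow>\<^sub>E UNIV"
  then show "hamming V x y = 0 \<longleftrightarrow> x = y"
    using assms by (auto simp: hamming_def sum_nonneg_eq_0_iff intro: PiE_ext)
qed

lemma sets_PiM_hamming:
  assumes fin: "finite V" and ne: "V \<noteq> {}"
  shows "sets (\<Pi>\<^sub>M v\<in>V. (borel :: 'h::polish_space measure)) =
    sigma_sets (V \<rightarrow>\<^sub>E UNIV) {U. openin (Metric_space.mtopology (V \<rightarrow>\<^sub>E UNIV) (hamming V)) U}"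
    (is "?P = sigma_sets ?X ?O")
proof
  interpret H: Metric_space ?X "hamming V"
    by (rule Metric_space_hamming[OF fin])
  have n: "real (card V) > 0"
    using fin ne by (simp add: card_gt_0_iff)
  show "sigma_sets ?X ?O \<subseteq> ?P"
  proof -
    have "U \<in> ?P" if U: "openin H.mtopology U" for U
    proof -
      obtain B :: "'h set set" where B: "countable B" "topological_basis B"
        using ex_countable_basis by blast
      define C where "C = {A \<in> V \<rightarrow>\<^sub>E B. Pi\<^sub>E V A \<subseteq> U}"
      have "countable C"
        unfolding C_def by (rule countable_subset[OF _ countable_PiE[OF fin B(1)]]) auto
      moreover have "Pi\<^sub>E V A \<in> ?P" if "A \<in> C" for A
        using that B(2) fin
        by (intro sets_PiM_I_finite) (auto simp: C_def PiE_iff topological_basis_open)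
      moreover have "U = (\<Union>A\<in>C. Pi\<^sub>E V A)"
      proof (intro equalityI subsetI)
        fix x assume x: "x \<in> U"
        from U x obtain e where e: "e > 0" "H.mball x e \<subseteq> U" and xX: "x \<in> ?X"
          unfolding H.openin_mtopology by blast
        have "\<exists>W. W \<in> B \<and> x v \<in> W \<and> W \<subseteq> ball (x v) e" for v
          using topological_basisE[OF B(2) open_ball, of "x v" "x v" e] e(1) by auto
        then obtain W where W: "\<And>v. W v \<in> B" "\<And>v. x v \<in> W v" "\<And>v. W v \<subseteq> ball (x v) e"
          by metis
        have "Pi\<^sub>E V W \<subseteq> U"
        proof
          fix y assume y: "y \<in> Pi\<^sub>E V W"
          have "(\<Sum>v\<in>V. dist (x v) (y v)) < (\<Sum>v\<in>V. e)"
            using y W(3) fin ne by (intro sum_strict_mono) (auto simp: PiE_iff subset_eq)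
          then have "hamming V x y < e"
            using n by (simp add: hamming_def divide_less_eq mult.commute)
          moreover have "y \<in> ?X" using y by (auto simp: PiE_iff)
          ultimately show "y \<in> U" using e(2) xX by auto
        qed
        then have "restrict W V \<in> C"
          unfolding C_def using W(1) by (auto simp: PiE_iff cong: PiE_cong)
        moreover have "x \<in> Pi\<^sub>E V (restrict W V)"
          using W(2) xX by (auto simp: PiE_iff)
        ultimately show "x \<in> (\<Union>A\<in>C. Pi\<^sub>E V A)" by blast
      qed (auto simp: C_def)
      ultimately show ?thesis
        by (simp only: sets.countable_UN'')
    qed
    then show ?thesis
      using sets.sigma_sets_subset[of ?O "\<Pi>\<^sub>M v\<in>V. (borel :: 'h measure)"]
      by (auto simp: space_PiM)
  qed
  show "?P \<subseteq> sigma_sets ?X ?O"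
  proof -
    define N where "N = sigma ?X ?O"
    have O: "?O \<subseteq> Pow ?X"
      using openin_subset by fastforce
    have N: "sets N = sigma_sets ?X ?O" "space N = ?X"
      using O by (auto simp: N_def)
    have "(\<lambda>x. x v) \<in> N \<rightarrow>\<^sub>M (borel :: 'h measure)" if v: "v \<in> V" for v
    proof (rule borel_measurableI)
      fix S :: "'h set" assume S: "open S"
      have "openin H.mtopology {x \<in> ?X. x v \<in> S}"
        unfolding H.openin_mtopology
      proof (intro conjI allI impI)
        fix x assume x: "x \<in> {x \<in> ?X. x v \<in> S}"
        then obtain e where e: "e > 0" "ball (x v) e \<subseteq> S"
          using S open_contains_ball by blast
        have "y v \<in> S" if y: "hamming V x y < e / card V" for y
        proof -
          have "dist (x v) (y v) \<le> (\<Sum>v\<in>V. dist (x v) (y v))"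
            using fin v by (intro member_le_sum) auto
          also have "\<dots> < e"
            using y n by (simp add: hamming_def divide_less_cancel)
          finally show ?thesis using e(2) by auto
        qed
        then show "\<exists>r>0. H.mball x r \<subseteq> {x \<in> ?X. x v \<in> S}"
          using e(1) n by (intro exI[of _ "e / card V"]) auto
      qed auto
      then have "{x \<in> ?X. x v \<in> S} \<in> sets N"
        by (simp add: N sigma_sets.Basic)
      then show "(\<lambda>x. x v) -` S \<inter> space N \<in> sets N"
        by (simp add: N vimage_def Int_def conj_commute)
    qed
    then have "(\<lambda>x. x) \<in> N \<rightarrow>\<^sub>M (\<Pi>\<^sub>M v\<in>V. (borel :: 'h measure))"
      by (intro measurable_PiM_single') (auto simp: N)
    from measurable_sets[OF this] show ?thesis
      using sets.sets_into_space[of _ "\<Pi>\<^sub>M v\<in>V. (borel :: 'h measure)"]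
      by (auto simp: N space_PiM Int_absorb2)
  qed
qed

lemma metric_prob_space_hamming:
  assumes "finite V" "V \<noteq> {}"
    and "\<nu> \<in> space (prob_algebra (\<Pi>\<^sub>M v\<in>V. (borel :: 'h::polish_space measure)))"
  shows "metric_prob_space (V \<rightarrow>\<^sub>E UNIV) (hamming V) \<nu>"
  using assms sets_eq_imp_space_eq[of \<nu> "\<Pi>\<^sub>M v\<in>V. (borel :: 'h measure)"]
  by (auto simp: metric_prob_space_def Metric_space_hamming sets_PiM_hamming[symmetric]
      space_prob_algebra space_PiM)

end

theory Submission
  imports Defs
begin

text \<open>The plan is McDiarmid's method of bounded differences, carried out along the tree. Visit the vertices
of \<open>T\<close> so that parents precede children, and reveal a \<open>\<nu>\<close>-random configuration one coordinate at a
time. Let \<open>f\<close> be \<open>1\<close>-Lipschitz for the Hamming metric on \<open>n\<close> sites. The conditional mean of \<open>f\<close>, given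
the coordinates revealed so far, then forms a martingale, and everything rests on how strongly this
conditional mean depends on the coordinate revealed last.

If a function depends on the coordinate at \<open>v\<close> with Lipschitz constant \<open>D v\<close>, then integrating this
coordinate out leaves a dependence on the coordinate at the parent with the additional constant
\<open>b * D v\<close>, because the law at \<open>v\<close> moves by at most \<open>b\<close> times the movement of the parent value, in the
transport metric. The constants therefore obey the recursion
\<open>D v = 1 / n + b * (\<Sum>u. D u)\<close>, the sum running over the children \<open>u\<close> of \<open>v\<close>; its solution is
\<open>\<delta> v / n\<close> with the descendant generating function \<open>\<delta>\<close>. Hoeffding's lemma, applied to each
increment, gives
\<open>\<integral> exp (l * (f - \<integral> f d\<nu>)) d\<nu> \<le> exp (l\<^sup>2 / 8 * (\<Delta> / n)\<^sup>2)\<close> with \<open>\<Delta> = Delta T b\<close>, and the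
exponential Markov inequality turns this into
\<open>\<nu> {f > \<epsilon>} \<le> exp (- 2 * (n * \<epsilon> / \<Delta>)\<^sup>2)\<close> for \<open>f\<close> of mean \<open>0\<close>. Both claims of the theorem can be read
off from this bound.

The analytic part is \<open>chain_concentration\<close>, for an abstract chain of kernels that resamples one
coordinate at a time; \<open>lipschitz_integral_diff_le_dbar\<close> provides its contraction hypothesis. The
combinatorial part, \<open>parent_props\<close> and \<open>iterated_children_gf_recursion\<close>, identifies the parents in a
graph-theoretic tree and solves the recursion. The two meet in \<open>markov_eq_chain\<close>, where a Markov
measure, defined by integrating over whole levels, is written as a chain over single vertices.\<close>

section \<open>Lipschitz functions and the transport metric\<close>

text \<open>The Hamming metric gives all coordinates the same weight, but integrating a coordinate out moves its
weight to the parent, so that unequal weights have to be admitted.\<close>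

definition weighted_lipschitz :: "'v set \<Rightarrow> ('v \<Rightarrow> real) \<Rightarrow> (('v \<Rightarrow> 'h::metric_space) \<Rightarrow> real) \<Rightarrow> bool" where
  "weighted_lipschitz V a f \<longleftrightarrow>
     (\<forall>x\<in>V \<rightarrow>\<^sub>E UNIV. \<forall>y\<in>V \<rightarrow>\<^sub>E UNIV. \<bar>f x - f y\<bar> \<le> (\<Sum>v\<in>V. a v * dist (x v) (y v)))"

lemma weighted_lipschitzD:
  "weighted_lipschitz V a f \<Longrightarrow> x \<in> V \<rightarrow>\<^sub>E UNIV \<Longrightarrow> y \<in> V \<rightarrow>\<^sub>E UNIV \<Longrightarrow>
    \<bar>f x - f y\<bar> \<le> (\<Sum>v\<in>V. a v * dist (x v) (y v))"
  by (simp add: weighted_lipschitz_def)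

lemma weighted_lipschitz_bounded:
  fixes f :: "('v \<Rightarrow> 'h::metric_space) \<Rightarrow> real"
  assumes f: "weighted_lipschitz V a f" and a: "\<And>v. v \<in> V \<Longrightarrow> 0 \<le> a v"
    and diam: "\<And>x y :: 'h. dist x y \<le> 1"
  obtains B where "\<And>x. x \<in> V \<rightarrow>\<^sub>E UNIV \<Longrightarrow> \<bar>f x\<bar> \<le> B"
proof -
  obtain x0 :: "'v \<Rightarrow> 'h" where x0: "x0 \<in> V \<rightarrow>\<^sub>E UNIV"
    using PiE_eq_empty_iff[of V "\<lambda>_. UNIV :: 'h set"] by blast
  have "\<bar>f x\<bar> \<le> \<bar>f x0\<bar> + (\<Sum>v\<in>V. a v)" if "x \<in> V \<rightarrow>\<^sub>E UNIV" for x
  proof -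
    have "(\<Sum>v\<in>V. a v * dist (x v) (x0 v)) \<le> (\<Sum>v\<in>V. a v * 1)"
      by (intro sum_mono mult_left_mono diam a)
    with weighted_lipschitzD[OF f that x0] show ?thesis by simp
  qed
  then show ?thesis by (rule that)
qed

text \<open>On a space of diameter at most \<open>1\<close> an \<open>L\<close>-Lipschitz function takes its values in an interval of length
\<open>L\<close>, and Hoeffding's lemma bounds the Laplace transform of any such random variable.\<close>

lemma hoeffding_lipschitz:
  fixes \<phi> :: "'h::metric_space \<Rightarrow> real"
  assumes M: "prob_space M" "sets M = sets borel"
    and lip: "L-lipschitz_on UNIV \<phi>" and diam: "\<And>x y :: 'h. dist x y \<le> 1" and l: "0 < l"
  shows "(\<integral>\<^sup>+x. exp (l * \<phi> x) \<partial>M) \<le> exp (l * integral\<^sup>L M \<phi> + l\<^sup>2 * L\<^sup>2 / 8)"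
    and "integrable M \<phi>"
proof -
  interpret prob_space M by fact
  define a where "a = Inf (range \<phi>)"
  have *: "\<phi> x \<le> \<phi> y + L" for x y
  proof -
    have "\<bar>\<phi> x - \<phi> y\<bar> \<le> L * dist x y"
      using lipschitz_onD[OF lip] by (simp add: dist_real_def)
    also have "\<dots> \<le> L * 1"
      by (intro mult_left_mono diam lipschitz_on_nonneg[OF lip])
    finally show ?thesis by simp
  qed
  have "bdd_below (range \<phi>)"
    by (rule bdd_belowI2[of _ "\<phi> undefined - L"]) (use * in \<open>simp add: algebra_simps\<close>)
  then have a1: "a \<le> \<phi> x" for x
    unfolding a_def by (intro cINF_lower) auto
  have a2: "\<phi> x \<le> a + L" for x
  proof -
    have "\<phi> x - L \<le> a"
      unfolding a_def by (intro cINF_greatest) (use * in \<open>auto simp: algebra_simps\<close>)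
    then show ?thesis by simp
  qed
  have [measurable]: "\<phi> \<in> borel_measurable M"
    using borel_measurable_continuous_onI[OF lipschitz_on_continuous_on[OF lip]]
    by (simp add: M cong: measurable_cong_sets)
  interpret interval_bounded_random_variable M \<phi> a "a + L"
    by unfold_locales (use a1 a2 in auto)
  show "integrable M \<phi>" ..
  have "(\<integral>\<^sup>+x. exp (l * \<phi> x) \<partial>M) =
      (\<integral>\<^sup>+x. ennreal (exp (l * expectation \<phi>)) * ennreal (exp (l * (\<phi> x - expectation \<phi>))) \<partial>M)"
    by (simp add: algebra_simps flip: exp_add ennreal_mult)
  also have "\<dots> = ennreal (exp (l * expectation \<phi>)) * (\<integral>\<^sup>+x. exp (l * (\<phi> x - expectation \<phi>)) \<partial>M)"
    by (rule nn_integral_cmult) measurable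
  also have "\<dots> \<le> ennreal (exp (l * expectation \<phi>)) * ennreal (exp (l\<^sup>2 * (a + L - a)\<^sup>2 / 8))"
    by (intro mult_left_mono Hoeffdings_lemma_nn_integral l refl) auto
  also have "\<dots> = exp (l * expectation \<phi> + l\<^sup>2 * L\<^sup>2 / 8)"
    by (simp add: exp_add ennreal_mult)
  finally show "(\<integral>\<^sup>+x. exp (l * \<phi> x) \<partial>M) \<le> exp (l * integral\<^sup>L M \<phi> + l\<^sup>2 * L\<^sup>2 / 8)" .
qed

lemma product_measure_in_couplings:
  fixes \<mu> \<nu> :: "'h::polish_space measure"
  assumes \<mu>: "prob_space \<mu>" "sets \<mu> = sets borel" and \<nu>: "prob_space \<nu>" "sets \<nu> = sets borel"
  shows "\<mu> \<Otimes>\<^sub>M \<nu> \<in> couplings \<mu> \<nu>"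
proof -
  interpret M: prob_space \<mu> by fact
  interpret N: prob_space \<nu> by fact
  interpret pair_prob_space \<mu> \<nu> ..
  have "distr (\<mu> \<Otimes>\<^sub>M \<nu>) borel fst = distr (\<mu> \<Otimes>\<^sub>M \<nu>) \<mu> fst"
    by (rule distr_cong) (simp_all add: \<mu>)
  moreover have "distr (\<mu> \<Otimes>\<^sub>M \<nu>) borel snd = distr (\<mu> \<Otimes>\<^sub>M \<nu>) \<nu> snd"
    by (rule distr_cong) (simp_all add: \<nu>)
  moreover have "sets (\<mu> \<Otimes>\<^sub>M \<nu>) = sets (borel \<Otimes>\<^sub>M borel)"
    by (rule sets_pair_measure_cong[OF \<mu>(2) \<nu>(2)])
  moreover have "distr (\<mu> \<Otimes>\<^sub>M \<nu>) \<nu> snd = \<nu>"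
  proof -
    have "distr (\<mu> \<Otimes>\<^sub>M \<nu>) \<nu> snd = distr (distr (\<nu> \<Otimes>\<^sub>M \<mu>) (\<mu> \<Otimes>\<^sub>M \<nu>) (\<lambda>(x, y). (y, x))) \<nu> snd"
      by (subst distr_pair_swap) simp
    also have "\<dots> = distr (\<nu> \<Otimes>\<^sub>M \<mu>) \<nu> fst"
      by (subst distr_distr) (auto simp: comp_def case_prod_beta)
    also have "\<dots> = \<nu>" by (rule M.distr_pair_fst)
    finally show ?thesis .
  qed
  moreover have "distr (\<mu> \<Otimes>\<^sub>M \<nu>) \<mu> fst = \<mu>" by (rule N.distr_pair_fst)
  ultimately show ?thesis
    by (simp add: couplings_def space_prob_algebra prob_space_pair \<mu> \<nu>)
qed

text \<open>This is the elementary half of Kantorovich duality: along any coupling the two integrals differ by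
the mean of \<open>\<phi> x - \<phi> y\<close>, which is at most \<open>L\<close> times the mean distance. That couplings exist matters,
because an infimum of reals over the empty set is an arbitrary number.\<close>

lemma lipschitz_integral_diff_le_dbar:
  fixes \<mu> \<nu> :: "'h::polish_space measure"
  assumes \<mu>: "prob_space \<mu>" "sets \<mu> = sets borel" and \<nu>: "prob_space \<nu>" "sets \<nu> = sets borel"
    and lip: "L-lipschitz_on UNIV \<phi>" and diam: "\<And>x y :: 'h. dist x y \<le> 1"
  shows "\<bar>integral\<^sup>L \<mu> \<phi> - integral\<^sup>L \<nu> \<phi>\<bar> \<le> L * dbar \<mu> \<nu>"
proof -
  have [measurable]: "\<phi> \<in> borel_measurable borel"
    by (rule borel_measurable_continuous_onI[OF lipschitz_on_continuous_on[OF lip]])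
  have int: "integrable \<mu> \<phi>" "integrable \<nu> \<phi>"
    using hoeffding_lipschitz(2)[OF \<mu> lip diam, of 1] hoeffding_lipschitz(2)[OF \<nu> lip diam, of 1] by auto
  have *: "\<bar>integral\<^sup>L \<mu> \<phi> - integral\<^sup>L \<nu> \<phi>\<bar> \<le> L * (\<integral>(x, y). dist x y \<partial>\<gamma>)"
    if "\<gamma> \<in> couplings \<mu> \<nu>" for \<gamma>
  proof -
    have \<gamma>: "prob_space \<gamma>" "sets \<gamma> = sets (borel \<Otimes>\<^sub>M borel)"
      "\<mu> = distr \<gamma> borel fst" "\<nu> = distr \<gamma> borel snd"
      using that by (auto simp: couplings_def space_prob_algebra)
    interpret prob_space \<gamma> by fact
    have m: "fst \<in> \<gamma> \<rightarrow>\<^sub>M (borel :: 'h measure)" "snd \<in> \<gamma> \<rightarrow>\<^sub>M (borel :: 'h measure)"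
      using \<gamma>(2) by (simp_all cong: measurable_cong_sets)
    have [measurable]: "(\<lambda>z. dist (fst z) (snd z)) \<in> borel_measurable \<gamma>"
      by (intro borel_measurable_dist m)
    have int_dist: "integrable \<gamma> (\<lambda>z. dist (fst z) (snd z))"
      by (rule integrable_const_bound[where B = 1]) (use diam in auto)
    have i: "integrable \<gamma> (\<lambda>z. \<phi> (fst z))" "integrable \<gamma> (\<lambda>z. \<phi> (snd z))"
      using int unfolding \<gamma>(3,4) by (simp_all add: integrable_distr_eq m)
    have "integral\<^sup>L \<mu> \<phi> - integral\<^sup>L \<nu> \<phi> = (\<integral>z. \<phi> (fst z) - \<phi> (snd z) \<partial>\<gamma>)"
      using i unfolding \<gamma>(3,4) by (simp add: integral_distr m)
    also have "\<bar>\<dots>\<bar> \<le> (\<integral>z. \<bar>\<phi> (fst z) - \<phi> (snd z)\<bar> \<partial>\<gamma>)"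
      using integral_norm_bound[of \<gamma> "\<lambda>z. \<phi> (fst z) - \<phi> (snd z)"] by simp
    also have "\<dots> \<le> (\<integral>z. L * dist (fst z) (snd z) \<partial>\<gamma>)"
      using lipschitz_onD[OF lip]
      by (intro integral_mono integrable_abs Bochner_Integration.integrable_diff i
          integrable_mult_right int_dist) (auto simp: dist_real_def)
    finally show ?thesis by (simp add: case_prod_beta')
  qed
  have ne: "couplings \<mu> \<nu> \<noteq> {}" using product_measure_in_couplings[OF \<mu> \<nu>] by blast
  show ?thesis
  proof (cases "L = 0")
    case True
    with * ne show ?thesis by auto
  next
    case False
    then have L: "0 < L" using lipschitz_on_nonneg[OF lip] by simp
    have "\<bar>integral\<^sup>L \<mu> \<phi> - integral\<^sup>L \<nu> \<phi>\<bar> / L \<le> dbar \<mu> \<nu>"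
      unfolding dbar_def using * L ne by (intro cINF_greatest) (auto simp: field_simps)
    with L show ?thesis by (simp add: field_simps)
  qed
qed

section \<open>Resampling the coordinates one at a time\<close>

text \<open>A Markov measure is built here by resampling one coordinate after another: the new value at \<open>v\<close> is
drawn from the kernel \<open>k v\<close>, applied to the current value at the parent \<open>p v\<close>. Every configuration on
the way is a total one, which keeps all the kernels on one measurable space; the arbitrary
values at the vertices not yet visited are overwritten before anything reads them when parents
precede children.\<close>

locale vertex_chain =
  fixes V :: "'v set" and p :: "'v \<Rightarrow> 'v" and k :: "'v \<Rightarrow> 'h::polish_space \<Rightarrow> 'h measure"
  assumes finite_V: "finite V"
    and parent_in: "\<And>v. v \<in> V \<Longrightarrow> p v \<in> V"
    and kernel: "\<And>v. v \<in> V \<Longrightarrow> k v \<in> borel \<rightarrow>\<^sub>M prob_algebra borel"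
begin

abbreviation config :: "('v \<Rightarrow> 'h) measure" where
  "config \<equiv> \<Pi>\<^sub>M v\<in>V. borel"

definition resample :: "'v \<Rightarrow> ('v \<Rightarrow> 'h) \<Rightarrow> ('v \<Rightarrow> 'h) measure" where
  "resample v y = distr (k v (y (p v))) config (\<lambda>x. y(v := x))"

primrec chain :: "'v list \<Rightarrow> ('v \<Rightarrow> 'h) \<Rightarrow> ('v \<Rightarrow> 'h) measure" where
  "chain [] y = return config y"
| "chain (v # vs) y = resample v y \<bind> chain vs"

lemma space_config: "space config = V \<rightarrow>\<^sub>E UNIV"
  by (simp add: space_PiM)

lemma upd_config: "v \<in> V \<Longrightarrow> y \<in> V \<rightarrow>\<^sub>E UNIV \<Longrightarrow> y(v := x) \<in> V \<rightarrow>\<^sub>E UNIV"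
  by (auto simp: PiE_iff extensional_def)

lemma measurable_upd:
  "v \<in> V \<Longrightarrow> (\<lambda>(y, x). y(v := x)) \<in> config \<Otimes>\<^sub>M (borel :: 'h measure) \<rightarrow>\<^sub>M config"
  using measurable_add_dim[of v V "\<lambda>_. borel :: 'h measure"] by (simp add: insert_absorb)

lemma measurable_upd1:
  "v \<in> V \<Longrightarrow> y \<in> V \<rightarrow>\<^sub>E UNIV \<Longrightarrow> (\<lambda>x. y(v := x)) \<in> (borel :: 'h measure) \<rightarrow>\<^sub>M config"
  using measurable_Pair2[OF measurable_upd] by (simp add: space_config)

lemma measurable_kernel_parent:
  assumes v: "v \<in> V"
  shows "(\<lambda>y. k v (y (p v))) \<in> config \<rightarrow>\<^sub>M prob_algebra borel"
  by (rule measurable_compose[OF _ kernel[OF v]])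
    (rule measurable_component_singleton[OF parent_in[OF v]])

lemma kernel_prob: "v \<in> V \<Longrightarrow> prob_space (k v s)"
  and kernel_sets: "v \<in> V \<Longrightarrow> sets (k v s) = sets borel"
  using measurable_space[OF kernel, of v s] by (auto simp: space_prob_algebra)

lemma resample_measurable: "v \<in> V \<Longrightarrow> resample v \<in> config \<rightarrow>\<^sub>M prob_algebra config"
  unfolding resample_def[abs_def]
  by (intro measurable_distr_prob_space2[OF measurable_kernel_parent] measurable_upd)

lemma chain_measurable: "set vs \<subseteq> V \<Longrightarrow> chain vs \<in> config \<rightarrow>\<^sub>M prob_algebra config"
proof (induction vs)
  case Nil
  have "chain [] = return config" by auto
  then show ?case by simp
next
  case (Cons v vs)
  have "chain (v # vs) = (\<lambda>y. resample v y \<bind> chain vs)" by auto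
  with Cons show ?case
    by (auto intro!: measurable_bind_prob_space resample_measurable)
qed

lemma chain_prob:
  assumes "set vs \<subseteq> V" "y \<in> V \<rightarrow>\<^sub>E UNIV"
  shows "prob_space (chain vs y)" "sets (chain vs y) = sets config"
  using measurable_space[OF chain_measurable, of vs y] assms
  by (auto simp: space_prob_algebra space_config)

lemma nn_integral_chain_Cons:
  assumes vs: "set (v # vs) \<subseteq> V" and y: "y \<in> V \<rightarrow>\<^sub>E UNIV" and F: "F \<in> borel_measurable config"
  shows "(\<integral>\<^sup>+x. F x \<partial>chain (v # vs) y) =
    (\<integral>\<^sup>+t. \<integral>\<^sup>+x. F x \<partial>chain vs (y(v := t)) \<partial>k v (y (p v)))"
proof -
  have v: "v \<in> V" using vs by simp
  have ch: "chain vs \<in> config \<rightarrow>\<^sub>M subprob_algebra config"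
    using vs by (intro measurable_prob_algebraD chain_measurable) auto
  have "(\<integral>\<^sup>+x. F x \<partial>chain (v # vs) y) = (\<integral>\<^sup>+z. \<integral>\<^sup>+x. F x \<partial>chain vs z \<partial>resample v y)"
    unfolding chain.simps
    by (rule nn_integral_bind[OF F]) (simp add: resample_def ch cong: measurable_cong_sets)
  also have "\<dots> = (\<integral>\<^sup>+t. \<integral>\<^sup>+x. F x \<partial>chain vs (y(v := t)) \<partial>k v (y (p v)))"
    unfolding resample_def
  proof (rule nn_integral_distr)
    show "(\<lambda>x. y(v := x)) \<in> k v (y (p v)) \<rightarrow>\<^sub>M config"
      using measurable_upd1[OF v y] by (simp add: kernel_sets[OF v] cong: measurable_cong_sets)
    show "(\<lambda>z. \<integral>\<^sup>+x. F x \<partial>chain vs z) \<in> borel_measurable (distr (k v (y (p v))) config (\<lambda>x. y(v := x)))"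
      using measurable_compose[OF ch nn_integral_measurable_subprob_algebra[OF F]]
      by (simp cong: measurable_cong_sets)
  qed
  finally show ?thesis .
qed

lemma integral_chain_Cons:
  fixes F :: "('v \<Rightarrow> 'h) \<Rightarrow> real"
  assumes vs: "set (v # vs) \<subseteq> V" and y: "y \<in> V \<rightarrow>\<^sub>E UNIV" and F: "F \<in> borel_measurable config"
    and B: "\<And>x. x \<in> V \<rightarrow>\<^sub>E UNIV \<Longrightarrow> \<bar>F x\<bar> \<le> B"
  shows "(\<integral>x. F x \<partial>chain (v # vs) y) =
    (\<integral>t. \<integral>x. F x \<partial>chain vs (y(v := t)) \<partial>k v (y (p v)))"
proof -
  have v: "v \<in> V" using vs by simp
  have ch: "chain vs \<in> config \<rightarrow>\<^sub>M subprob_algebra config"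
    using vs by (intro measurable_prob_algebraD chain_measurable) auto
  have R: "prob_space (resample v y)" "sets (resample v y) = sets config"
    using measurable_space[OF resample_measurable[OF v], of y] y
    by (auto simp: space_prob_algebra space_config)
  have "(\<integral>x. F x \<partial>chain (v # vs) y) = (\<integral>z. \<integral>x. F x \<partial>chain vs z \<partial>resample v y)"
    unfolding chain.simps
  proof (rule integral_bind[OF F])
    show "\<And>x. x \<in> space config \<Longrightarrow> \<bar>F x\<bar> \<le> B" using B by (simp add: space_config)
    show "chain vs \<in> resample v y \<rightarrow>\<^sub>M subprob_algebra config"
      using ch R by (simp cong: measurable_cong_sets)
    show "finite_measure (resample v y)"
      using R(1) by (rule prob_space.finite_measure)
    show "AE x in resample v y. emeasure (chain vs x) (space (chain vs x)) \<le> ennreal 1"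
    proof (rule AE_I2)
      fix z assume "z \<in> space (resample v y)"
      then have "z \<in> V \<rightarrow>\<^sub>E UNIV" using sets_eq_imp_space_eq[OF R(2)] by (simp add: space_config)
      then show "emeasure (chain vs z) (space (chain vs z)) \<le> ennreal 1"
        using chain_prob(1)[of vs z] vs by (simp add: prob_space.emeasure_space_1)
    qed
  qed
  also have "\<dots> = (\<integral>t. \<integral>x. F x \<partial>chain vs (y(v := t)) \<partial>k v (y (p v)))"
    unfolding resample_def
  proof (rule integral_distr)
    show "(\<lambda>x. y(v := x)) \<in> k v (y (p v)) \<rightarrow>\<^sub>M config"
      using measurable_upd1[OF v y] by (simp add: kernel_sets[OF v] cong: measurable_cong_sets)
    show "(\<lambda>z. \<integral>x. F x \<partial>chain vs z) \<in> borel_measurable config"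
      by (rule measurable_compose[OF ch integral_measurable_subprob_algebra[OF F]])
  qed
  finally show ?thesis .
qed

lemma override_config: "I \<subseteq> V \<Longrightarrow> y \<in> V \<rightarrow>\<^sub>E UNIV \<Longrightarrow> override_on y z I \<in> V \<rightarrow>\<^sub>E UNIV"
  by (auto simp: PiE_iff extensional_def override_on_def)

lemma measurable_override:
  assumes I: "I \<subseteq> V" and y: "y \<in> V \<rightarrow>\<^sub>E UNIV"
  shows "(\<lambda>z. override_on y z I) \<in> (\<Pi>\<^sub>M v\<in>I. (borel :: 'h measure)) \<rightarrow>\<^sub>M config"
proof (rule measurable_PiM_single')
  show "(\<lambda>z. override_on y z I) \<in> space (\<Pi>\<^sub>M v\<in>I. (borel :: 'h measure)) \<rightarrow> (\<Pi>\<^sub>E i\<in>V. space borel)"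
    using override_config[OF I y] by simp
  fix v
  show "(\<lambda>z. override_on y z I v) \<in> (\<Pi>\<^sub>M v\<in>I. (borel :: 'h measure)) \<rightarrow>\<^sub>M borel"
    by (cases "v \<in> I") simp_all
qed

text \<open>When no parent of the listed vertices is listed, resampling them one by one is the same as drawing
them all at once from a product measure: none of the updates changes the argument of a later
kernel. This matches the one-by-one construction with integration level by level.\<close>

lemma nn_integral_block:
  assumes G: "G \<in> borel_measurable config"
    and us: "set us \<subseteq> V" "distinct us" and p: "\<And>v. v \<in> set us \<Longrightarrow> p v \<notin> set us"
    and y: "y \<in> V \<rightarrow>\<^sub>E UNIV"
  shows "(\<integral>\<^sup>+x. G x \<partial>chain us y) =
    (\<integral>\<^sup>+z. G (override_on y z (set us)) \<partial>(\<Pi>\<^sub>M v\<in>set us. k v (y (p v))))"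
  using us p y
proof (induction us arbitrary: y)
  case Nil
  have "(\<integral>\<^sup>+x. G x \<partial>chain [] y) = G y"
    using Nil.prems(4) by (simp add: nn_integral_return[OF _ G] space_config)
  then show ?case
    by (simp add: PiM_empty nn_integral_count_space_finite)
next
  case (Cons u us)
  \<comment> \<open>The Fubini rule for products wants a \<open>\<sigma>\<close>-finite measure at every index, so the family is
    filled up with point masses outside \<open>V\<close>.\<close>
  define M where "M v = (if v \<in> V then k v (y (p v)) else return borel undefined)" for v
  have "prob_space (M v)" for v
    by (simp add: M_def kernel_prob prob_space_return)
  then interpret product_sigma_finite M
    by (intro product_sigma_finite.intro prob_space_imp_sigma_finite)
  have u: "u \<in> V" "u \<notin> set us" "set us \<subseteq> V" "distinct us" using Cons.prems by auto
  have sets_M: "sets (M v) = sets borel" for v by (simp add: M_def kernel_sets)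
  have p': "(y(u := t)) (p v) = y (p v)" if "v \<in> set us" for v t
    using Cons.prems(3)[of v] that by auto
  have "(\<integral>\<^sup>+x. G x \<partial>chain (u # us) y) = (\<integral>\<^sup>+t. \<integral>\<^sup>+x. G x \<partial>chain us (y(u := t)) \<partial>M u)"
    using u by (subst nn_integral_chain_Cons[OF Cons.prems(1,4) G]) (simp add: M_def)
  also have "\<dots> = (\<integral>\<^sup>+t. \<integral>\<^sup>+z. G (override_on (y(u := t)) z (set us)) \<partial>Pi\<^sub>M (set us) M \<partial>M u)"
  proof (rule nn_integral_cong)
    fix t
    have "(\<integral>\<^sup>+x. G x \<partial>chain us (y(u := t))) =
        (\<integral>\<^sup>+z. G (override_on (y(u := t)) z (set us)) \<partial>(\<Pi>\<^sub>M v\<in>set us. k v ((y(u := t)) (p v))))"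
      by (rule Cons.IH) (use u Cons.prems upd_config in auto)
    also have "(\<Pi>\<^sub>M v\<in>set us. k v ((y(u := t)) (p v))) = Pi\<^sub>M (set us) M"
      using u(3) by (intro PiM_cong) (auto simp: M_def p' simp del: fun_upd_apply)
    finally show "(\<integral>\<^sup>+x. G x \<partial>chain us (y(u := t))) =
        (\<integral>\<^sup>+z. G (override_on (y(u := t)) z (set us)) \<partial>Pi\<^sub>M (set us) M)" .
  qed
  also have "\<dots> = (\<integral>\<^sup>+t. \<integral>\<^sup>+z. G (override_on y (z(u := t)) (insert u (set us))) \<partial>Pi\<^sub>M (set us) M \<partial>M u)"
  proof -
    have "override_on (y(u := t)) z (set us) = override_on y (z(u := t)) (insert u (set us))" for t z
      using u(2) by (auto simp: override_on_def fun_eq_iff)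
    then show ?thesis by simp
  qed
  also have "\<dots> = (\<integral>\<^sup>+z. G (override_on y z (insert u (set us))) \<partial>Pi\<^sub>M (insert u (set us)) M)"
  proof (rule product_nn_integral_insert_rev[symmetric])
    have "(\<lambda>z. override_on y z (insert u (set us))) \<in> Pi\<^sub>M (insert u (set us)) M \<rightarrow>\<^sub>M config"
      using measurable_override[of "insert u (set us)" y] u Cons.prems(4)
      by (simp add: sets_M cong: measurable_cong_sets sets_PiM_cong)
    then show "(\<lambda>z. G (override_on y z (insert u (set us)))) \<in> borel_measurable (Pi\<^sub>M (insert u (set us)) M)"
      by (rule measurable_compose[OF _ G])
  qed (use u in auto)
  also have "Pi\<^sub>M (insert u (set us)) M = (\<Pi>\<^sub>M v\<in>set (u # us). k v (y (p v)))"
    using u by (intro PiM_cong) (auto simp: M_def)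
  finally show ?case by simp
qed

lemma chain_append:
  assumes "set us \<subseteq> V" "set vs \<subseteq> V" "y \<in> V \<rightarrow>\<^sub>E UNIV" and F: "F \<in> borel_measurable config"
  shows "(\<integral>\<^sup>+x. F x \<partial>chain (us @ vs) y) = (\<integral>\<^sup>+z. \<integral>\<^sup>+x. F x \<partial>chain vs z \<partial>chain us y)"
  using assms(1,3)
proof (induction us arbitrary: y)
  case Nil
  have "(\<lambda>z. \<integral>\<^sup>+x. F x \<partial>chain vs z) \<in> borel_measurable config"
    by (rule measurable_compose[OF measurable_prob_algebraD[OF chain_measurable[OF assms(2)]]
          nn_integral_measurable_subprob_algebra[OF F]])
  with Nil show ?case by (simp add: nn_integral_return space_config)
next
  case (Cons u us)
  have G: "(\<lambda>z. \<integral>\<^sup>+x. F x \<partial>chain vs z) \<in> borel_measurable config"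
    by (rule measurable_compose[OF measurable_prob_algebraD[OF chain_measurable[OF assms(2)]]
          nn_integral_measurable_subprob_algebra[OF F]])
  have "(\<integral>\<^sup>+x. F x \<partial>chain (u # us @ vs) y) =
      (\<integral>\<^sup>+t. \<integral>\<^sup>+x. F x \<partial>chain (us @ vs) (y(u := t)) \<partial>k u (y (p u)))"
    by (rule nn_integral_chain_Cons) (use assms Cons.prems in auto)
  also have "\<dots> = (\<integral>\<^sup>+t. \<integral>\<^sup>+z. \<integral>\<^sup>+x. F x \<partial>chain vs z \<partial>chain us (y(u := t)) \<partial>k u (y (p u)))"
    by (intro nn_integral_cong Cons.IH upd_config) (use Cons.prems in auto)
  also have "\<dots> = (\<integral>\<^sup>+z. \<integral>\<^sup>+x. F x \<partial>chain vs z \<partial>chain (u # us) y)"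
    by (rule nn_integral_chain_Cons[symmetric]) (use Cons.prems G in auto)
  finally show ?case by simp
qed

end

section \<open>Concentration for chains of contracting kernels\<close>

text \<open>The contraction hypothesis is the dual form of the transport estimate
\<open>dbar (k v s) (k v t) \<le> \<beta> v * dist s t\<close>. The constant may vary with \<open>v\<close> so that the root, whose law
does not depend on any other value, can be given the constant \<open>0\<close>.\<close>

locale lipschitz_vertex_chain = vertex_chain V p k
  for V :: "'v set" and p :: "'v \<Rightarrow> 'v" and k :: "'v \<Rightarrow> 'h::polish_space \<Rightarrow> 'h measure" +
  fixes \<beta> :: "'v \<Rightarrow> real"
  assumes diam: "\<And>x y :: 'h. dist x y \<le> 1"
    and \<beta>_nonneg: "\<And>v. 0 \<le> \<beta> v"
    and contraction: "\<And>v s t L \<phi>. v \<in> V \<Longrightarrow> L-lipschitz_on UNIV \<phi> \<Longrightarrow>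
      \<bar>integral\<^sup>L (k v s) \<phi> - integral\<^sup>L (k v t) \<phi>\<bar> \<le> L * (\<beta> v * dist s t)"
begin

lemma lipschitz_slice:
  fixes M :: "('v \<Rightarrow> 'h) \<Rightarrow> real"
  assumes M: "weighted_lipschitz V w M" and v: "v \<in> V" and w: "w v \<le> C" "0 \<le> C"
    and y: "y \<in> V \<rightarrow>\<^sub>E UNIV"
  shows "C-lipschitz_on UNIV (\<lambda>t. M (y(v := t)))"
proof (rule lipschitz_onI)
  fix s t :: 'h
  have "\<bar>M (y(v := s)) - M (y(v := t))\<bar> \<le> (\<Sum>u\<in>V. w u * dist ((y(v := s)) u) ((y(v := t)) u))"
    by (intro weighted_lipschitzD[OF M] upd_config v y)
  also have "\<dots> = (\<Sum>u\<in>V. if u = v then w v * dist s t else 0)"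
    by (intro sum.cong) auto
  also have "\<dots> = w v * dist s t"
    using finite_V v by simp
  also have "\<dots> \<le> C * dist s t"
    by (intro mult_right_mono w) auto
  finally show "dist (M (y(v := s))) (M (y(v := t))) \<le> C * dist s t"
    by (simp add: dist_real_def)
qed (rule w(2))

text \<open>Integrating out the vertices of \<open>vs\<close> removes their own weights. The weight that \<open>x\<close> carried when it was
integrated out, bounded by \<open>D x\<close> and damped by \<open>\<beta> x\<close>, is charged to the parent of \<open>x\<close>.\<close>

definition residual :: "('v \<Rightarrow> real) \<Rightarrow> ('v \<Rightarrow> real) \<Rightarrow> 'v list \<Rightarrow> 'v \<Rightarrow> real" where
  "residual a D vs u =
     (if u \<in> set vs then 0 else a u) + (\<Sum>x\<in>set vs. if p x = u then \<beta> x * D x else 0)"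

text \<open>Both claims are proved together by induction on the list, the first vertex being integrated out
last. Let \<open>M\<close> be the mean over the remaining vertices, as a function of the configuration. Replacing
the value at \<open>v\<close> by an integral against \<open>k v\<close> changes the weights of \<open>M\<close> in two ways: the value at
\<open>v\<close> is forgotten, and the dependence of the kernel on the value at \<open>p v\<close> contributes a further
\<open>\<beta> v * D v\<close> there, by contraction applied to the \<open>D v\<close>-Lipschitz slice of \<open>M\<close> at \<open>v\<close>.
Hoeffding's lemma applied to the same slice costs the factor \<open>exp (l\<^sup>2 * (D v)\<^sup>2 / 8)\<close> in the Laplace
transform. The weight of \<open>v\<close> at the time of its visit comes only from \<open>v\<close> itself and from
children of \<open>v\<close>, so that the recursive inequality for \<open>D\<close> bounds it by \<open>D v\<close>.\<close>

lemma chain_concentration: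
  fixes F :: "('v \<Rightarrow> 'h) \<Rightarrow> real"
  assumes F: "F \<in> borel_measurable config" "weighted_lipschitz V a F"
    and a: "\<And>v. 0 \<le> a v"
    and D_nonneg: "\<And>v. 0 \<le> D v"
    and D: "\<And>v. v \<in> V \<Longrightarrow> a v + (\<Sum>x\<in>V. if p x = v then \<beta> x * D x else 0) \<le> D v"
    and l: "0 < l"
    and vs: "set vs \<subseteq> V" "distinct vs"
  shows "weighted_lipschitz V (residual a D vs) (\<lambda>y. integral\<^sup>L (chain vs y) F) \<and>
    (\<forall>y\<in>V \<rightarrow>\<^sub>E UNIV. (\<integral>\<^sup>+x. exp (l * F x) \<partial>chain vs y) \<le>
      exp (l * integral\<^sup>L (chain vs y) F + l\<^sup>2 / 8 * (\<Sum>v\<in>set vs. (D v)\<^sup>2)))"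
  using vs
proof (induction vs)
  case Nil
  have "integral\<^sup>L (return config y) F = F y" if "y \<in> V \<rightarrow>\<^sub>E UNIV" for y
    using that F(1) by (intro integral_return) (auto simp: space_config)
  moreover have "(\<integral>\<^sup>+x. exp (l * F x) \<partial>return config y) = exp (l * F y)" if "y \<in> V \<rightarrow>\<^sub>E UNIV" for y
    using that F(1) by (intro nn_integral_return) (auto simp: space_config)
  ultimately show ?case
    using F(2) by (simp add: weighted_lipschitz_def residual_def)
next
  case (Cons v vs)
  define M where "M y = integral\<^sup>L (chain vs y) F" for y
  define w where "w = residual a D vs"
  define S where "S = (\<Sum>v\<in>set vs. (D v)\<^sup>2)"
  have v: "v \<in> V" "v \<notin> set vs" "set vs \<subseteq> V" using Cons.prems by auto
  have M: "weighted_lipschitz V w M"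
    and exp_M: "\<And>y. y \<in> V \<rightarrow>\<^sub>E UNIV \<Longrightarrow>
      (\<integral>\<^sup>+x. exp (l * F x) \<partial>chain vs y) \<le> exp (l * M y + l\<^sup>2 / 8 * S)"
    using Cons.IH Cons.prems unfolding M_def w_def S_def by auto
  obtain B where B: "\<And>x. x \<in> V \<rightarrow>\<^sub>E UNIV \<Longrightarrow> \<bar>F x\<bar> \<le> B"
    using weighted_lipschitz_bounded[OF F(2) a diam] by metis
  have wv: "w v \<le> D v"
  proof -
    have "w v \<le> a v + (\<Sum>x\<in>V. if p x = v then \<beta> x * D x else 0)"
      unfolding w_def residual_def using v finite_V
      by (auto intro!: sum_mono2 mult_nonneg_nonneg \<beta>_nonneg D_nonneg)
    with D[OF v(1)] show ?thesis by simp
  qed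
  have slice: "(D v)-lipschitz_on UNIV (\<lambda>t. M (y(v := t)))" if "y \<in> V \<rightarrow>\<^sub>E UNIV" for y
    by (rule lipschitz_slice[OF M v(1) wv D_nonneg that])
  have mean: "integral\<^sup>L (chain (v # vs) y) F = (\<integral>t. M (y(v := t)) \<partial>k v (y (p v)))"
    if "y \<in> V \<rightarrow>\<^sub>E UNIV" for y
    unfolding M_def by (intro integral_chain_Cons[where B = B] that F B) (use Cons.prems in auto)
  have integrable_slice: "integrable (k v s) (\<lambda>t. M (y(v := t)))" if "y \<in> V \<rightarrow>\<^sub>E UNIV" for y s
    by (rule hoeffding_lipschitz(2)[OF kernel_prob[OF v(1)] kernel_sets[OF v(1)] slice[OF that] diam l])
  have "weighted_lipschitz V (residual a D (v # vs)) (\<lambda>y. integral\<^sup>L (chain (v # vs) y) F)"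
    unfolding weighted_lipschitz_def
  proof (intro ballI)
    fix y y' :: "'v \<Rightarrow> 'h" assume y: "y \<in> V \<rightarrow>\<^sub>E UNIV" "y' \<in> V \<rightarrow>\<^sub>E UNIV"
    let ?q = "k v (y (p v))" and ?q' = "k v (y' (p v))"
    let ?R = "\<Sum>u\<in>V. (if u = v then 0 else w u) * dist (y u) (y' u)"
    interpret q: prob_space ?q by (rule kernel_prob[OF v(1)])
    have "\<bar>(\<integral>t. M (y(v := t)) \<partial>?q) - (\<integral>t. M (y'(v := t)) \<partial>?q)\<bar> =
        \<bar>\<integral>t. M (y(v := t)) - M (y'(v := t)) \<partial>?q\<bar>"
      by (simp add: integrable_slice y)
    also have "\<dots> \<le> (\<integral>t. \<bar>M (y(v := t)) - M (y'(v := t))\<bar> \<partial>?q)"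
      using integral_norm_bound[of ?q "\<lambda>t. M (y(v := t)) - M (y'(v := t))"] by simp
    also have "\<dots> \<le> (\<integral>t. ?R \<partial>?q)"
    proof (rule integral_mono)
      show "integrable ?q (\<lambda>t. \<bar>M (y(v := t)) - M (y'(v := t))\<bar>)"
        by (intro integrable_abs Bochner_Integration.integrable_diff integrable_slice y)
      fix t
      have "\<bar>M (y(v := t)) - M (y'(v := t))\<bar> \<le> (\<Sum>u\<in>V. w u * dist ((y(v := t)) u) ((y'(v := t)) u))"
        by (intro weighted_lipschitzD[OF M] upd_config v y)
      also have "\<dots> = ?R" by (intro sum.cong) auto
      finally show "\<bar>M (y(v := t)) - M (y'(v := t))\<bar> \<le> ?R" .
    qed simp
    also have "\<dots> = ?R" by (simp add: q.prob_space)
    finally have 1: "\<bar>(\<integral>t. M (y(v := t)) \<partial>?q) - (\<integral>t. M (y'(v := t)) \<partial>?q)\<bar> \<le> ?R" .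
    have "\<bar>(\<integral>t. M (y'(v := t)) \<partial>?q) - (\<integral>t. M (y'(v := t)) \<partial>?q')\<bar> \<le>
        D v * (\<beta> v * dist (y (p v)) (y' (p v)))"
      by (rule contraction[OF v(1) slice[OF y(2)]])
    also have "\<dots> = (\<Sum>u\<in>V. if p v = u then \<beta> v * D v * dist (y u) (y' u) else 0)"
      using finite_V parent_in[OF v(1)] by (simp add: mult_ac)
    also have "\<dots> = (\<Sum>u\<in>V. (if p v = u then \<beta> v * D v else 0) * dist (y u) (y' u))"
      by (intro sum.cong) auto
    finally have 2: "\<bar>(\<integral>t. M (y'(v := t)) \<partial>?q) - (\<integral>t. M (y'(v := t)) \<partial>?q')\<bar> \<le>
        (\<Sum>u\<in>V. (if p v = u then \<beta> v * D v else 0) * dist (y u) (y' u))" .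
    \<comment> \<open>The first bound moves the configuration under a fixed law at \<open>v\<close>, the second moves the law
      under a fixed configuration.\<close>
    have "\<bar>integral\<^sup>L (chain (v # vs) y) F - integral\<^sup>L (chain (v # vs) y') F\<bar> \<le>
        ?R + (\<Sum>u\<in>V. (if p v = u then \<beta> v * D v else 0) * dist (y u) (y' u))"
      using 1 2 unfolding mean[OF y(1)] mean[OF y(2)] by linarith
    also have "\<dots> = (\<Sum>u\<in>V. ((if u = v then 0 else w u) + (if p v = u then \<beta> v * D v else 0)) * dist (y u) (y' u))"
      by (simp add: sum.distrib[symmetric] distrib_right)
    also have "\<dots> \<le> (\<Sum>u\<in>V. residual a D (v # vs) u * dist (y u) (y' u))"
    proof (intro sum_mono mult_right_mono)
      fix u
      have "0 \<le> (\<Sum>x\<in>set vs. if p x = u then \<beta> x * D x else 0)"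
        by (intro sum_nonneg) (auto intro!: mult_nonneg_nonneg \<beta>_nonneg D_nonneg)
      then show "(if u = v then 0 else w u) + (if p v = u then \<beta> v * D v else 0) \<le> residual a D (v # vs) u"
        using v(2) by (auto simp: w_def residual_def)
    qed simp
    finally show "\<bar>integral\<^sup>L (chain (v # vs) y) F - integral\<^sup>L (chain (v # vs) y') F\<bar> \<le>
        (\<Sum>u\<in>V. residual a D (v # vs) u * dist (y u) (y' u))" .
  qed
  moreover have "(\<integral>\<^sup>+x. exp (l * F x) \<partial>chain (v # vs) y) \<le>
      exp (l * integral\<^sup>L (chain (v # vs) y) F + l\<^sup>2 / 8 * (\<Sum>v\<in>set (v # vs). (D v)\<^sup>2))"
    if y: "y \<in> V \<rightarrow>\<^sub>E UNIV" for y
  proof -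
    let ?q = "k v (y (p v))"
    have [measurable]: "(\<lambda>t. M (y(v := t))) \<in> borel_measurable ?q"
      using integrable_slice[OF y] by (rule borel_measurable_integrable)
    have "(\<integral>\<^sup>+x. exp (l * F x) \<partial>chain (v # vs) y) =
        (\<integral>\<^sup>+t. \<integral>\<^sup>+x. exp (l * F x) \<partial>chain vs (y(v := t)) \<partial>?q)"
      using F(1) by (intro nn_integral_chain_Cons y) (use Cons.prems in auto)
    also have "\<dots> \<le> (\<integral>\<^sup>+t. exp (l\<^sup>2 / 8 * S) * exp (l * M (y(v := t))) \<partial>?q)"
      by (intro nn_integral_mono order_trans[OF exp_M] upd_config v y)
        (simp add: exp_add mult.commute flip: ennreal_mult)
    also have "\<dots> = exp (l\<^sup>2 / 8 * S) * (\<integral>\<^sup>+t. exp (l * M (y(v := t))) \<partial>?q)"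
      by (simp add: ennreal_mult nn_integral_cmult)
    also have "\<dots> \<le> ennreal (exp (l\<^sup>2 / 8 * S)) *
        ennreal (exp (l * (\<integral>t. M (y(v := t)) \<partial>?q) + l\<^sup>2 * (D v)\<^sup>2 / 8))"
      by (intro mult_left_mono
          hoeffding_lipschitz(1)[OF kernel_prob[OF v(1)] kernel_sets[OF v(1)] slice[OF y] diam l]) auto
    also have "\<dots> = exp (l * integral\<^sup>L (chain (v # vs) y) F + l\<^sup>2 / 8 * (\<Sum>v\<in>set (v # vs). (D v)\<^sup>2))"
      using v(2) by (simp add: mean[OF y] S_def algebra_simps add_divide_distrib flip: ennreal_mult exp_add del: chain.simps)
    finally show ?thesis .
  qed
  ultimately show ?case by blast
qed

end

section \<open>Parents and descendants in a finite rooted tree\<close>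

lemma walk_in_verts: "walk T u xs v \<Longrightarrow> u \<in> verts T \<and> v \<in> verts T"
  unfolding walk_def by (metis hd_in_set last_in_set subsetD)

lemma walk_append:
  assumes "walk T u xs v" "walk T v ys w"
  shows "walk T u (xs @ tl ys) w"
proof (cases "tl ys = []")
  case True
  then have "ys = [v]" using assms(2) by (cases ys) (auto simp: walk_def)
  then have "v = w" using assms(2) by (simp add: walk_def)
  with True assms(1) show ?thesis by simp
next
  case False
  then obtain y zs where ys: "ys = v # y # zs"
    using assms(2) by (cases ys rule: remdups_adj.cases) (auto simp: walk_def)
  show ?thesis
    using assms unfolding walk_def ys by (auto simp: successively_append_iff)
qed

lemma walk_rev: "walk T u xs v \<Longrightarrow> walk T v (rev xs) u"
  by (auto simp: walk_def successively_rev hd_rev last_rev insert_commute)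

lemma walk_snocE: "walk T u xs v \<Longrightarrow> \<exists>zs. xs = zs @ [v]"
  by (cases xs rule: rev_cases) (auto simp: walk_def)

lemma walk_prefix: "walk T u (xs @ x # ys) v \<Longrightarrow> walk T u (xs @ [x]) x"
  by (auto simp: walk_def successively_append_iff hd_append)

lemma walk_snoc:
  "walk T u xs v \<Longrightarrow> {v, w} \<in> edges T \<Longrightarrow> w \<in> verts T \<Longrightarrow> walk T u (xs @ [w]) w"
  by (auto simp: walk_def successively_append_iff)

lemma simple_path_of_walk:
  assumes "walk T u xs v"
  shows "\<exists>ys. simple_path T u ys v \<and> set ys \<subseteq> set xs"
  using assms
proof (induction "length xs" arbitrary: xs rule: less_induct)
  case less
  show ?case
  proof (cases "distinct xs")
    case True
    with less.prems show ?thesis by (auto simp: simple_path_def)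
  next
    case False
    then obtain as bs cs z where xs: "xs = as @ [z] @ bs @ [z] @ cs"
      using not_distinct_decomp by blast
    have "walk T u (as @ z # cs) v"
      using less.prems unfolding xs walk_def
      by (auto simp: successively_append_iff successively_Cons hd_append)
    from less.hyps[OF _ this] show ?thesis by (fastforce simp: xs)
  qed
qed

lemma graph_dist_le: "walk T u xs v \<Longrightarrow> graph_dist T u v \<le> length xs - 1"
  unfolding graph_dist_def by (rule Least_le) (auto simp: walk_def)

lemma shortest_walk:
  assumes "walk T u xs v"
  shows "\<exists>ys. walk T u ys v \<and> length ys = Suc (graph_dist T u v)"
proof -
  have "\<exists>ys. walk T u ys v \<and> length ys = Suc (length xs - 1)"
    using assms by (auto simp: walk_def)
  then show ?thesis
    unfolding graph_dist_def by (rule LeastI)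
qed

locale rooted_tree =
  fixes T :: "'v rooted_graph"
  assumes tree: "finite_rooted_tree T"
begin

abbreviation lvl :: "'v \<Rightarrow> nat" where
  "lvl \<equiv> graph_dist T (root T)"

lemma finite_verts: "finite (verts T)"
  and root_in: "root T \<in> verts T"
  and connected: "u \<in> verts T \<Longrightarrow> v \<in> verts T \<Longrightarrow> \<exists>xs. walk T u xs v"
  and acyclic: "\<not> is_cycle T xs"
  using tree by (auto simp: finite_rooted_tree_def)

lemma edgeD: "{u, v} \<in> edges T \<Longrightarrow> u \<in> verts T \<and> v \<in> verts T \<and> u \<noteq> v"
  using tree unfolding finite_rooted_tree_def by (fastforce simp: doubleton_eq_iff)

lemma root_walk: "v \<in> verts T \<Longrightarrow> \<exists>xs. walk T (root T) xs v \<and> length xs = Suc (lvl v)"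
  using connected[OF root_in] shortest_walk by metis

lemma lvl_root: "lvl (root T) = 0"
  using graph_dist_le[of T "root T" "[root T]" "root T"] root_in by (simp add: walk_def)

lemma lvl_eq_0_iff: "v \<in> verts T \<Longrightarrow> lvl v = 0 \<longleftrightarrow> v = root T"
  using root_walk[of v] lvl_root by (auto simp: length_Suc_conv walk_def)

lemma lvl_edge_le:
  assumes e: "{u, v} \<in> edges T"
  shows "lvl v \<le> Suc (lvl u)"
proof -
  obtain xs where xs: "walk T (root T) xs u" "length xs = Suc (lvl u)"
    using root_walk edgeD[OF e] by blast
  have "walk T (root T) (xs @ [v]) v"
    using edgeD[OF e] by (intro walk_snoc[OF xs(1) e]) auto
  from graph_dist_le[OF this] show ?thesis by (simp add: xs(2))
qed

lemma shortest_walk_lvl: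
  assumes xs: "walk T (root T) xs v" "length xs = Suc (lvl v)" and x: "x \<in> set xs"
  shows "lvl x \<le> lvl v"
proof -
  obtain as bs where s: "xs = as @ x # bs" using x by (auto simp: in_set_conv_decomp)
  with graph_dist_le[OF walk_prefix, of T "root T" as x bs v] xs show ?thesis by simp
qed

lemma walk_from_root_avoiding:
  assumes "u \<in> verts T" "lvl u < lvl v"
  shows "\<exists>xs. walk T (root T) xs u \<and> v \<notin> set xs"
  using root_walk[OF assms(1)] shortest_walk_lvl assms(2) by (metis leD)

text \<open>The vertex before \<open>v\<close> on a shortest walk from the root is the natural candidate for the parent. It
is closer to the root by exactly one level: not more, since one further step reaches \<open>v\<close>.\<close>

lemma predecessor_exists:
  assumes v: "v \<in> verts T" "v \<noteq> root T"
  shows "\<exists>u. {u, v} \<in> edges T \<and> Suc (lvl u) = lvl v"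
proof -
  obtain xs where xs: "walk T (root T) xs v" "length xs = Suc (lvl v)"
    using root_walk[OF v(1)] by blast
  obtain m where m: "lvl v = Suc m" using lvl_eq_0_iff[OF v(1)] v(2) by (cases "lvl v") auto
  obtain zs where zs: "xs = zs @ [v]" using walk_snocE[OF xs(1)] by blast
  with xs(2) m have "zs \<noteq> []" by auto
  then obtain ys u where "zs = ys @ [u]" by (metis rev_exhaust)
  with zs have s: "xs = (ys @ [u]) @ [v]" by simp
  have e: "{u, v} \<in> edges T" using xs(1) unfolding s walk_def by (auto simp: successively_append_iff)
  have "walk T (root T) (ys @ [u]) u" using walk_prefix[of T _ ys u "[v]"] xs(1) s by simp
  from graph_dist_le[OF this] xs(2) have "Suc (lvl u) \<le> lvl v" by (simp add: s)
  with lvl_edge_le[OF e] e show ?thesis by (auto intro!: exI[of _ u])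
qed

lemma tree_le_of_lvl:
  assumes e: "{u, v} \<in> edges T" and l: "lvl u < lvl v"
  shows "tree_le T u v"
proof -
  obtain xs where xs: "walk T (root T) xs u" "v \<notin> set xs"
    using walk_from_root_avoiding[OF _ l] edgeD[OF e] by blast
  obtain ys where ys: "simple_path T (root T) ys u" "set ys \<subseteq> set xs"
    using simple_path_of_walk[OF xs(1)] by blast
  have "u \<in> set ys" using ys(1) by (auto simp: simple_path_def walk_def)
  moreover have "simple_path T (root T) (ys @ [v]) v"
    using ys xs(2) edgeD[OF e] e by (auto simp: simple_path_def intro: walk_snoc)
  ultimately show ?thesis unfolding tree_le_def by (intro exI[of _ "ys @ [v]"]) auto
qed

text \<open>This is where acyclicity enters. If two different neighbours of \<open>v\<close> could both be reached from the
root without passing through \<open>v\<close>, then the two walks, joined at the root and reduced to a simple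
path, would close up to a cycle through \<open>v\<close>.\<close>

lemma neighbour_towards_root_unique:
  assumes e: "{u, v} \<in> edges T" "{w, v} \<in> edges T"
    and u: "walk T (root T) xs u" "v \<notin> set xs" and w: "walk T (root T) ys w" "v \<notin> set ys"
  shows "u = w"
proof (rule ccontr)
  assume ne: "u \<noteq> w"
  obtain zs where zs: "simple_path T u zs w" "set zs \<subseteq> set (rev xs @ tl ys)"
    using simple_path_of_walk[OF walk_append[OF walk_rev[OF u(1)] w(1)]] by blast
  have "set (tl ys) \<subseteq> set ys" by (cases ys) auto
  then have "v \<notin> set zs" using zs(2) u(2) w(2) by auto
  moreover have "hd zs = u" "last zs = w" "zs \<noteq> []" using zs(1) by (auto simp: simple_path_def walk_def)
  moreover have "2 \<le> length zs"
    using calculation ne by (cases zs rule: remdups_adj.cases) auto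
  ultimately have "is_cycle T (zs @ [v])"
    using zs(1) e edgeD[OF e(1)]
    by (auto simp: is_cycle_def simple_path_def insert_commute intro!: walk_snoc)
  with acyclic show False by blast
qed

text \<open>The definite description defining the parent is justified by comparing an arbitrary neighbour of \<open>v\<close>
that is below \<open>v\<close> in the tree order with the predecessor on a shortest walk: both are reached from
the root without passing through \<open>v\<close>.\<close>

lemma parent_props:
  assumes v: "v \<in> verts T" "v \<noteq> root T"
  shows "parent T v \<in> verts T" "{parent T v, v} \<in> edges T" "Suc (lvl (parent T v)) = lvl v"
proof -
  obtain u where u: "{u, v} \<in> edges T" "Suc (lvl u) = lvl v"
    using predecessor_exists[OF v] by blast
  have "parent T v = u"
    unfolding parent_def
  proof (rule the_equality)
    show "{u, v} \<in> edges T \<and> tree_le T u v" using u tree_le_of_lvl by auto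
    fix w assume w: "{w, v} \<in> edges T \<and> tree_le T w v"
    then obtain xs where xs: "simple_path T (root T) xs v" "w \<in> set xs"
      by (auto simp: tree_le_def)
    obtain zs where zs: "xs = zs @ [v]"
      using xs(1) walk_snocE unfolding simple_path_def by metis
    have "w \<in> set zs" using xs(2) edgeD[of w v] w by (auto simp: zs)
    then obtain as bs where s: "zs = as @ w # bs" by (auto simp: in_set_conv_decomp)
    have zw: "walk T (root T) (as @ [w]) w" "v \<notin> set (as @ [w])"
      using xs(1) walk_prefix[of T "root T" as w "bs @ [v]" v] by (auto simp: simple_path_def zs s)
    obtain ys where ys: "walk T (root T) ys u" "v \<notin> set ys"
      using walk_from_root_avoiding[of u v] u edgeD[OF u(1)] by auto
    show "w = u"
      using w by (intro neighbour_towards_root_unique[OF _ u(1) zw ys]) auto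
  qed
  then show "parent T v \<in> verts T" "{parent T v, v} \<in> edges T" "Suc (lvl (parent T v)) = lvl v"
    using u edgeD by auto
qed

lemma iterated_parent:
  assumes w: "w \<in> verts T" and r: "r \<le> lvl w"
  shows "(parent T ^^ r) w \<in> verts T" "lvl ((parent T ^^ r) w) = lvl w - r"
  using r
proof (induction r)
  case (Suc r)
  { case 1 then show ?case
      using Suc lvl_root by (auto intro!: parent_props(1)) }
  { case 2 then show ?case
      using Suc lvl_root parent_props(3)[of "(parent T ^^ r) w"] by (cases "(parent T ^^ r) w = root T") auto }
qed (use w in auto)

lemma ancestor_path:
  assumes w: "w \<in> verts T" and r: "r \<le> lvl w"
  shows "simple_path T ((parent T ^^ r) w) (rev (map (\<lambda>i. (parent T ^^ i) w) [0..<Suc r])) w"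
proof -
  have "walk T ((parent T ^^ r) w) (rev (map (\<lambda>i. (parent T ^^ i) w) [0..<Suc r])) w"
    using r
  proof (induction r)
    case 0
    then show ?case using w by (simp add: walk_def)
  next
    case (Suc r)
    let ?u = "(parent T ^^ r) w" and ?xs = "rev (map (\<lambda>i. (parent T ^^ i) w) [0..<Suc r])"
    have u: "?u \<in> verts T" "?u \<noteq> root T"
      using iterated_parent[OF w, of r] Suc.prems lvl_root by auto
    have "walk T ?u ?xs w" using Suc by simp
    then have "walk T (parent T ?u) (parent T ?u # ?xs) w"
      using parent_props[OF u] by (cases ?xs) (auto simp: walk_def)
    then show ?case by simp
  qed
  moreover have "inj_on (\<lambda>i. (parent T ^^ i) w) {0..<Suc r}"
  proof (rule inj_onI)
    fix i j assume ij: "i \<in> {0..<Suc r}" "j \<in> {0..<Suc r}" "(parent T ^^ i) w = (parent T ^^ j) w"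
    then have "lvl w - i = lvl w - j"
      using iterated_parent(2)[OF w, of i] iterated_parent(2)[OF w, of j] r by auto
    then show "i = j" using ij(1,2) r by auto
  qed
  ultimately show ?thesis by (simp add: simple_path_def distinct_map del: upt_Suc)
qed

text \<open>The bound on \<open>r\<close> keeps the iteration from running past the root, whose parent is an arbitrary
vertex.\<close>

definition iterated_children :: "nat \<Rightarrow> 'v \<Rightarrow> 'v set" where
  "iterated_children r v = {w \<in> verts T. r \<le> lvl w \<and> (parent T ^^ r) w = v}"

text \<open>The vertices whose \<open>r\<close>-th iterated parent is \<open>v\<close> are exactly the descendants of \<open>v\<close> at distance \<open>r\<close>.
The inclusion proved here bounds their number by the descendant count. The chain of parents is a
simple path because it drops one level at each step; it is a shortest one because a single step
changes the level by at most one.\<close>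

lemma iterated_children_subset: "iterated_children r v \<subseteq> descendants_at T r v"
proof
  fix w assume "w \<in> iterated_children r v"
  then have w: "w \<in> verts T" "r \<le> lvl w" and v: "(parent T ^^ r) w = v"
    by (auto simp: iterated_children_def)
  let ?xs = "\<lambda>r. rev (map (\<lambda>i. (parent T ^^ i) w) [0..<Suc r])"
  have "(parent T ^^ lvl w) w = root T"
    using iterated_parent[OF w(1), of "lvl w"] lvl_eq_0_iff by auto
  then have "simple_path T (root T) (?xs (lvl w)) w"
    using ancestor_path[OF w(1), of "lvl w"] by simp
  moreover have "v \<in> set (?xs (lvl w))"
    using w(2) v by (force simp del: upt_Suc)
  ultimately have "tree_le T v w" unfolding tree_le_def by blast
  moreover have "graph_dist T v w = r"
  proof (rule antisym)
    have W: "walk T v (?xs r) w"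
      using ancestor_path[OF w] v by (simp add: simple_path_def)
    from graph_dist_le[OF this] show "graph_dist T v w \<le> r" by simp
    obtain ys where ys: "walk T v ys w" "length ys = Suc (graph_dist T v w)"
      using shortest_walk[OF W] by blast
    obtain xs where xs: "walk T (root T) xs v" "length xs = Suc (lvl v)"
      using root_walk[of v] walk_in_verts[OF W] by blast
    have "lvl w \<le> lvl v + graph_dist T v w"
      using graph_dist_le[OF walk_append[OF xs(1) ys(1)]] xs(2) ys(2) by simp
    then show "r \<le> graph_dist T v w"
      using iterated_parent(2)[OF w] v w(2) by simp
  qed
  ultimately show "w \<in> descendants_at T r v" using w(1) by (simp add: descendants_at_def)
qed

lemma iterated_children_0: "v \<in> verts T \<Longrightarrow> iterated_children 0 v = {v}"
  by (auto simp: iterated_children_def)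

lemma lvl_le_depth: "w \<in> verts T \<Longrightarrow> lvl w \<le> depth T"
  unfolding depth_def using finite_verts by (intro Max_ge) auto

lemma iterated_children_Suc:
  "iterated_children (Suc r) v =
    (\<Union>u\<in>{u \<in> verts T. u \<noteq> root T \<and> parent T u = v}. iterated_children r u)"
proof (intro equalityI subsetI)
  fix w assume "w \<in> iterated_children (Suc r) v"
  then have w: "w \<in> verts T" "Suc r \<le> lvl w" "parent T ((parent T ^^ r) w) = v"
    by (auto simp: iterated_children_def)
  then show "w \<in> (\<Union>u\<in>{u \<in> verts T. u \<noteq> root T \<and> parent T u = v}. iterated_children r u)"
    using iterated_parent[OF w(1), of r] lvl_root by (auto simp: iterated_children_def)
next
  fix w assume "w \<in> (\<Union>u\<in>{u \<in> verts T. u \<noteq> root T \<and> parent T u = v}. iterated_children r u)"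
  then have w: "w \<in> verts T" "r \<le> lvl w" "(parent T ^^ r) w \<noteq> root T" "parent T ((parent T ^^ r) w) = v"
    by (auto simp: iterated_children_def)
  have "lvl w - r \<noteq> 0"
    using iterated_parent[OF w(1,2)] w(3) lvl_eq_0_iff by metis
  with w show "w \<in> iterated_children (Suc r) v" by (auto simp: iterated_children_def)
qed

definition iterated_children_gf :: "real \<Rightarrow> 'v \<Rightarrow> real" where
  "iterated_children_gf b v = (\<Sum>r\<le>depth T. real (card (iterated_children r v)) * b ^ r)"

lemma iterated_children_gf_nonneg: "0 \<le> b \<Longrightarrow> 0 \<le> iterated_children_gf b v"
  unfolding iterated_children_gf_def by (intro sum_nonneg) auto

text \<open>Each vertex contributes \<open>1\<close> for itself and passes \<open>b\<close> times its own total on to its parent. This is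
the recursion for the weights in the concentration estimate for chains of kernels.\<close>

lemma iterated_children_gf_recursion:
  assumes v: "v \<in> verts T"
  shows "iterated_children_gf b v = 1 + (\<Sum>u | u \<in> verts T \<and> u \<noteq> root T \<and> parent T u = v. b * iterated_children_gf b u)"
    (is "_ = 1 + (\<Sum>u\<in>?C. _)")
proof -
  have card: "card (iterated_children (Suc r) v) = (\<Sum>u\<in>?C. card (iterated_children r u))" for r
    unfolding iterated_children_Suc
    by (rule card_UN_disjoint) (use finite_verts in \<open>auto simp: iterated_children_def\<close>)
  have last: "iterated_children (Suc (depth T)) v = {}"
    using lvl_le_depth by (fastforce simp: iterated_children_def)
  have "1 + (\<Sum>u\<in>?C. b * iterated_children_gf b u) =
      1 + (\<Sum>r\<le>depth T. \<Sum>u\<in>?C. b * (real (card (iterated_children r u)) * b ^ r))"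
    unfolding iterated_children_gf_def by (subst sum.swap) (simp add: sum_distrib_left)
  also have "\<dots> = (\<Sum>r\<le>Suc (depth T). real (card (iterated_children r v)) * b ^ r)"
    by (subst sum.atMost_Suc_shift)
      (simp add: iterated_children_0[OF v] card sum_distrib_left mult_ac)
  also have "\<dots> = iterated_children_gf b v" by (simp add: last iterated_children_gf_def)
  finally show ?thesis by simp
qed

lemma iterated_children_gf_le:
  assumes b: "0 \<le> b"
  shows "iterated_children_gf b v \<le> descendant_gf T b v"
proof -
  let ?g = "\<lambda>r. real (card (descendants_at T r v)) * b ^ r"
  have fin: "finite (descendants_at T r v)" for r
    using finite_verts by (simp add: descendants_at_def)
  have summable: "summable ?g"
  proof (rule summable_finite)
    show "finite (graph_dist T v ` verts T)" using finite_verts by simp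
    fix r assume "r \<notin> graph_dist T v ` verts T"
    then have "descendants_at T r v = {}" by (auto simp: descendants_at_def)
    then show "?g r = 0" by simp
  qed
  have "iterated_children_gf b v \<le> (\<Sum>r\<le>depth T. ?g r)"
    unfolding iterated_children_gf_def using b fin iterated_children_subset
    by (intro sum_mono mult_right_mono) (auto intro!: card_mono)
  also have "\<dots> \<le> suminf ?g"
    using summable b by (intro sum_le_suminf) auto
  finally show ?thesis by (simp add: descendant_gf_def)
qed

lemma iterated_children_gf_ge_1: "0 \<le> b \<Longrightarrow> v \<in> verts T \<Longrightarrow> 1 \<le> iterated_children_gf b v"
  by (subst iterated_children_gf_recursion) (auto intro!: sum_nonneg mult_nonneg_nonneg iterated_children_gf_nonneg)

lemma sum_iterated_children_gf_le_Delta: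
  assumes b: "0 \<le> b"
  shows "(\<Sum>v\<in>verts T. (iterated_children_gf b v)\<^sup>2) \<le> (Delta T b)\<^sup>2"
  unfolding Delta_def
  by (subst real_sqrt_pow2) (auto intro!: sum_nonneg sum_mono power_mono iterated_children_gf_le iterated_children_gf_nonneg b)

lemma Delta_pos:
  assumes b: "0 \<le> b"
  shows "0 < Delta T b"
proof -
  have "1 \<le> (iterated_children_gf b (root T))\<^sup>2"
    using iterated_children_gf_ge_1[OF b root_in] by simp
  also have "\<dots> \<le> (\<Sum>v\<in>verts T. (iterated_children_gf b v)\<^sup>2)"
    using finite_verts root_in by (intro member_le_sum) auto
  also have "\<dots> \<le> (Delta T b)\<^sup>2" by (rule sum_iterated_children_gf_le_Delta[OF b])
  finally have "Delta T b \<noteq> 0" by auto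
  moreover have "0 \<le> Delta T b" unfolding Delta_def by (intro real_sqrt_ge_zero sum_nonneg) auto
  ultimately show ?thesis by simp
qed

lemma level_iff: "v \<in> level T j \<longleftrightarrow> v \<in> verts T \<and> lvl v = j"
  by (auto simp: level_def)

definition level_list :: "nat \<Rightarrow> 'v list" where
  "level_list j = (SOME xs. set xs = level T j \<and> distinct xs)"

lemma level_list: "set (level_list j) = level T j" "distinct (level_list j)"
proof -
  have "finite (level T j)" using finite_verts by (simp add: level_def)
  from someI_ex[OF finite_distinct_list[OF this]]
  show "set (level_list j) = level T j" "distinct (level_list j)"
    by (auto simp: level_list_def)
qed

definition levels_list :: "nat \<Rightarrow> nat \<Rightarrow> 'v list" where
  "levels_list j n = concat (map level_list [j..<j + n])"

lemma levels_list_0: "levels_list j 0 = []"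
  and levels_list_Suc: "levels_list j (Suc n) = level_list j @ levels_list (Suc j) n"
  by (auto simp: levels_list_def upt_conv_Cons simp del: upt_Suc)

lemma set_levels_list: "set (levels_list j n) = {v \<in> verts T. j \<le> lvl v \<and> lvl v < j + n}"
  by (auto simp: levels_list_def level_list level_iff)

lemma distinct_levels_list: "distinct (levels_list j n)"
  by (induction n arbitrary: j)
    (auto simp: levels_list_0 levels_list_Suc level_list level_iff set_levels_list)

lemma breadth_first_list:
  "set (root T # levels_list 1 (depth T)) = verts T" "distinct (root T # levels_list 1 (depth T))"
proof -
  show "distinct (root T # levels_list 1 (depth T))"
    by (simp add: distinct_levels_list set_levels_list lvl_root)
  have "v = root T \<or> 1 \<le> lvl v \<and> lvl v < 1 + depth T" if "v \<in> verts T" for v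
    using lvl_eq_0_iff[OF that] lvl_le_depth[OF that] by linarith
  then show "set (root T # levels_list 1 (depth T)) = verts T"
    using root_in by (auto simp: set_levels_list)
qed

end

section \<open>Markov measures indexed by a tree\<close>

locale tree_markov = rooted_tree T
  for T :: "'v rooted_graph" +
  fixes \<nu>0 :: "'h::polish_space measure" and q :: "'v \<Rightarrow> 'h \<Rightarrow> 'h measure"
    and \<nu> :: "('v \<Rightarrow> 'h) measure"
  assumes markov: "markov_measure T \<nu>0 q \<nu>"
begin

text \<open>The root is made its own parent and its law a constant kernel, so that it is visited like every other
vertex, by a kernel that ignores its argument.\<close>

definition par :: "'v \<Rightarrow> 'v" where
  "par v = (if v = root T then root T else parent T v)"

definition ker :: "'v \<Rightarrow> 'h \<Rightarrow> 'h measure" where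
  "ker v = (if v = root T then (\<lambda>_. \<nu>0) else q v)"

sublocale vertex_chain "verts T" par ker
proof
  show "finite (verts T)" by (rule finite_verts)
  show "par v \<in> verts T" if "v \<in> verts T" for v
    using that root_in parent_props(1) by (auto simp: par_def)
  show "ker v \<in> borel \<rightarrow>\<^sub>M prob_algebra borel" if "v \<in> verts T" for v
    using that markov by (auto simp: ker_def markov_measure_def)
qed

text \<open>Parents lie one level closer to the root, so that no vertex of a level has its parent in the same
level and its product integral can be taken one vertex at a time.\<close>

lemma level_integrals_eq_chain:
  assumes F: "F \<in> borel_measurable config" and j: "0 < j" and y: "y \<in> verts T \<rightarrow>\<^sub>E UNIV"
  shows "level_integrals T q n j F y = (\<integral>\<^sup>+x. F x \<partial>chain (levels_list j n) y)"
  using j y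
proof (induction n arbitrary: j y)
  case 0
  then show ?case
    by (simp add: levels_list_0 nn_integral_return[OF _ F] space_config)
next
  case (Suc n)
  have lev: "set (level_list j) = level T j" "level T j \<subseteq> verts T"
    by (auto simp: level_list level_iff)
  have sub: "set (levels_list (Suc j) n) \<subseteq> verts T" by (auto simp: set_levels_list)
  have root: "v \<noteq> root T" if "v \<in> level T j" for v
    using that Suc.prems(1) lvl_root by (auto simp: level_iff)
  have par: "par v \<notin> level T j" if "v \<in> level T j" for v
    using that root[OF that] parent_props(3)[of v] by (auto simp: level_iff par_def)
  have G: "(\<lambda>z. \<integral>\<^sup>+x. F x \<partial>chain (levels_list (Suc j) n) z) \<in> borel_measurable config"
    by (rule measurable_compose[OF measurable_prob_algebraD[OF chain_measurable[OF sub]]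
          nn_integral_measurable_subprob_algebra[OF F]])
  have "level_integrals T q (Suc n) j F y =
      (\<integral>\<^sup>+z. \<integral>\<^sup>+x. F x \<partial>chain (levels_list (Suc j) n) (override_on y z (level T j))
        \<partial>(\<Pi>\<^sub>M v\<in>level T j. q v (y (parent T v))))"
    unfolding level_integrals.simps
    by (intro nn_integral_cong Suc.IH override_config lev Suc.prems) simp
  also have "(\<Pi>\<^sub>M v\<in>level T j. q v (y (parent T v))) = (\<Pi>\<^sub>M v\<in>set (level_list j). ker v (y (par v)))"
    using root by (intro PiM_cong) (auto simp: lev ker_def par_def)
  also have "(\<integral>\<^sup>+z. \<integral>\<^sup>+x. F x \<partial>chain (levels_list (Suc j) n) (override_on y z (level T j))
      \<partial>(\<Pi>\<^sub>M v\<in>set (level_list j). ker v (y (par v)))) =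
      (\<integral>\<^sup>+z. \<integral>\<^sup>+x. F x \<partial>chain (levels_list (Suc j) n) z \<partial>chain (level_list j) y)"
    by (subst nn_integral_block[OF G]) (use lev par Suc.prems level_list(2) in auto)
  also have "\<dots> = (\<integral>\<^sup>+x. F x \<partial>chain (levels_list j (Suc n)) y)"
    unfolding levels_list_Suc by (rule chain_append[symmetric]) (use lev sub Suc.prems F in auto)
  finally show ?case .
qed

definition sites :: "'v list" where
  "sites = root T # levels_list 1 (depth T)"

lemma sites: "set sites = verts T" "distinct sites"
  unfolding sites_def by (rule breadth_first_list)+

lemma markov_eq_chain: "\<nu> = chain sites (\<lambda>v. undefined)"
proof (rule measure_eqI)
  have y0: "(\<lambda>v. undefined) \<in> verts T \<rightarrow>\<^sub>E UNIV" by auto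
  have sub: "set (levels_list 1 (depth T)) \<subseteq> verts T" by (auto simp: set_levels_list)
  have \<nu>: "sets \<nu> = sets config"
    using markov by (simp add: markov_measure_def space_prob_algebra)
  have c: "sets (chain sites (\<lambda>v. undefined)) = sets config"
    using chain_prob(2)[OF _ y0] sites(1) by auto
  show "sets \<nu> = sets (chain sites (\<lambda>v. undefined))" by (simp add: \<nu> c)
  fix A assume A: "A \<in> sets \<nu>"
  have F: "indicator A \<in> borel_measurable config"
    using A \<nu> by simp
  have "emeasure \<nu> A =
      (\<integral>\<^sup>+t. level_integrals T q (depth T) 1 (indicator A) ((\<lambda>_. undefined)(root T := t)) \<partial>\<nu>0)"
    using markov A by (auto simp: markov_measure_def)
  also have "\<dots> = (\<integral>\<^sup>+t. \<integral>\<^sup>+x. indicator A x \<partial>chain (levels_list 1 (depth T)) ((\<lambda>_. undefined)(root T := t))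
      \<partial>\<nu>0)"
    by (intro nn_integral_cong level_integrals_eq_chain F upd_config root_in y0) simp
  also have "\<dots> = (\<integral>\<^sup>+x. indicator A x \<partial>chain sites (\<lambda>v. undefined))"
    unfolding sites_def using root_in sub
    by (subst nn_integral_chain_Cons[OF _ y0 F]) (auto simp: ker_def)
  also have "\<dots> = emeasure (chain sites (\<lambda>v. undefined)) A"
    using A \<nu> c by simp
  finally show "emeasure \<nu> A = emeasure (chain sites (\<lambda>v. undefined)) A" .
qed

end

locale lipschitz_tree_markov = tree_markov T \<nu>0 q \<nu>
  for T :: "'v rooted_graph" and \<nu>0 :: "'h::polish_space measure"
    and q :: "'v \<Rightarrow> 'h \<Rightarrow> 'h measure" and \<nu> :: "('v \<Rightarrow> 'h) measure" +
  fixes b :: real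
  assumes b_nonneg: "0 \<le> b"
    and diam_le_1: "\<And>x y :: 'h. dist x y \<le> 1"
    and lipschitz_kernels: "\<And>v x y. v \<in> verts T \<Longrightarrow> v \<noteq> root T \<Longrightarrow> dbar (q v x) (q v y) \<le> b * dist x y"
begin

definition coeff :: "'v \<Rightarrow> real" where
  "coeff v = (if v = root T then 0 else b)"

sublocale lipschitz_vertex_chain "verts T" par ker coeff
proof
  show "dist x y \<le> 1" for x y :: 'h by (rule diam_le_1)
  show "0 \<le> coeff v" for v using b_nonneg by (simp add: coeff_def)
  fix v s t L and \<phi> :: "'h \<Rightarrow> real" assume v: "v \<in> verts T" and lip: "L-lipschitz_on UNIV \<phi>"
  show "\<bar>integral\<^sup>L (ker v s) \<phi> - integral\<^sup>L (ker v t) \<phi>\<bar> \<le> L * (coeff v * dist s t)"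
  proof (cases "v = root T")
    case False
    have "\<bar>integral\<^sup>L (ker v s) \<phi> - integral\<^sup>L (ker v t) \<phi>\<bar> \<le> L * dbar (ker v s) (ker v t)"
      by (intro lipschitz_integral_diff_le_dbar kernel_prob kernel_sets v lip diam_le_1)
    also have "\<dots> \<le> L * (coeff v * dist s t)"
      using lipschitz_kernels[OF v False] False
      by (intro mult_left_mono lipschitz_on_nonneg[OF lip]) (simp add: ker_def coeff_def)
    finally show ?thesis .
  qed (simp add: ker_def coeff_def)
qed

text \<open>A \<open>1\<close>-Lipschitz function for the normalized Hamming metric starts with the weight \<open>1 / n\<close> everywhere,
and by its recursion the generating function divided by \<open>n\<close> bounds the weight of each vertex at its
visit.\<close>

lemma laplace_bound:
  assumes f: "f \<in> Lip1 (verts T \<rightarrow>\<^sub>E UNIV) (hamming (verts T))" "f \<in> borel_measurable config" and l: "0 < l"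
  shows "(\<integral>\<^sup>+x. exp (l * f x) \<partial>\<nu>) \<le>
    exp (l * integral\<^sup>L \<nu> f + l\<^sup>2 / 8 * (Delta T b / real (card (verts T)))\<^sup>2)"
proof -
  define n where "n = real (card (verts T))"
  define D where "D v = iterated_children_gf b v / n" for v
  have n: "0 < n" unfolding n_def using finite_verts root_in by (auto simp: card_gt_0_iff)
  have lip: "weighted_lipschitz (verts T) (\<lambda>_. 1 / n) f"
    using f(1) by (simp add: weighted_lipschitz_def Lip1_def hamming_def n_def sum_divide_distrib)
  \<comment> \<open>The coefficient \<open>0\<close> of the root removes its spurious contribution to itself as its own parent.\<close>
  have D: "1 / n + (\<Sum>x\<in>verts T. if par x = v then coeff x * D x else 0) \<le> D v"
    if v: "v \<in> verts T" for v
  proof -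
    have "(\<Sum>x\<in>verts T. if par x = v then coeff x * D x else 0) =
        (\<Sum>u | u \<in> verts T \<and> u \<noteq> root T \<and> parent T u = v. b * D u)"
      using finite_verts
      by (intro sum.mono_neutral_cong_right) (auto simp: par_def coeff_def)
    then show ?thesis
      by (simp add: D_def iterated_children_gf_recursion[OF v] add_divide_distrib sum_divide_distrib)
  qed
  have "(\<integral>\<^sup>+x. exp (l * f x) \<partial>\<nu>) \<le> exp (l * integral\<^sup>L \<nu> f + l\<^sup>2 / 8 * (\<Sum>v\<in>verts T. (D v)\<^sup>2))"
    using chain_concentration[OF f(2) lip _ _ D l, of sites] n b_nonneg iterated_children_gf_nonneg
    by (auto simp: markov_eq_chain sites D_def)
  also have "\<dots> \<le> exp (l * integral\<^sup>L \<nu> f + l\<^sup>2 / 8 * (Delta T b / n)\<^sup>2)"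
    using sum_iterated_children_gf_le_Delta[OF b_nonneg] n
    by (intro ennreal_leI)
      (auto simp: D_def power_divide simp flip: sum_divide_distrib intro!: divide_right_mono mult_left_mono)
  finally show ?thesis by (simp add: n_def)
qed

text \<open>The exponential Markov inequality is applied with the parameter \<open>l = 4 * \<epsilon> / \<sigma>\<^sup>2\<close> that minimizes
\<open>l\<^sup>2 * \<sigma>\<^sup>2 / 8 - l * \<epsilon>\<close>.\<close>

lemma concentration_bound:
  assumes \<epsilon>: "0 < \<epsilon>"
  shows "0 \<le> concentration (verts T \<rightarrow>\<^sub>E UNIV) (hamming (verts T)) \<nu> \<epsilon>"
    and "concentration (verts T \<rightarrow>\<^sub>E UNIV) (hamming (verts T)) \<nu> \<epsilon> \<le>
      exp (- 2 * (real (card (verts T)) * \<epsilon> / Delta T b)\<^sup>2)"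
proof -
  let ?X = "verts T \<rightarrow>\<^sub>E (UNIV :: 'h set)" and ?n = "real (card (verts T))"
  define \<sigma> where "\<sigma> = Delta T b / ?n"
  have n: "0 < ?n" using finite_verts root_in by (auto simp: card_gt_0_iff)
  then have \<sigma>: "0 < \<sigma>" using Delta_pos[OF b_nonneg] by (simp add: \<sigma>_def)
  interpret prob_space \<nu> using markov by (simp add: markov_measure_def space_prob_algebra)
  have sets: "sets \<nu> = sets config"
    using markov by (simp add: markov_measure_def space_prob_algebra)
  have space: "space \<nu> = ?X"
    using sets_eq_imp_space_eq[OF sets] by (simp add: space_config)
  let ?A = "{f \<in> Lip1 ?X (hamming (verts T)). integrable \<nu> f \<and> integral\<^sup>L \<nu> f = 0}"
  have zero: "(\<lambda>_. 0) \<in> ?A" by (simp add: Lip1_def hamming_def sum_nonneg)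
  have "0 \<le> measure \<nu> {x \<in> ?X. (\<lambda>_. 0) x > \<epsilon>}" by simp
  also have "\<dots> \<le> concentration ?X (hamming (verts T)) \<nu> \<epsilon>"
    unfolding concentration_def by (rule cSUP_upper[OF zero]) (auto intro!: bdd_aboveI2[where M = 1])
  finally show "0 \<le> concentration ?X (hamming (verts T)) \<nu> \<epsilon>" .
  show "concentration ?X (hamming (verts T)) \<nu> \<epsilon> \<le> exp (- 2 * (?n * \<epsilon> / Delta T b)\<^sup>2)"
    unfolding concentration_def
  proof (rule cSUP_least)
    show "?A \<noteq> {}" using zero by blast
    fix f assume "f \<in> ?A"
    then have f: "f \<in> Lip1 ?X (hamming (verts T))" "integrable \<nu> f" "integral\<^sup>L \<nu> f = 0" by auto
    have meas: "f \<in> borel_measurable \<nu>" using f(2) by (rule borel_measurable_integrable)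
    then have meas': "f \<in> borel_measurable config" using sets by (simp cong: measurable_cong_sets)
    define l where "l = 4 * \<epsilon> / \<sigma>\<^sup>2"
    have l: "0 < l" using \<epsilon> \<sigma> by (simp add: l_def)
    have "emeasure \<nu> {x \<in> ?X. f x > \<epsilon>} \<le> emeasure \<nu> {x \<in> space \<nu>. f x \<ge> \<epsilon>}"
    proof (rule emeasure_mono)
      show "{x \<in> space \<nu>. f x \<ge> \<epsilon>} \<in> sets \<nu>" using meas by measurable
    qed (auto simp: space)
    also have "\<dots> \<le> ennreal (exp (- l * \<epsilon>)) * (\<integral>\<^sup>+x. ennreal (exp (l * f x)) * indicator (space \<nu>) x \<partial>\<nu>)"
      using meas by (intro Chernoff_ineq_nn_integral_ge l) auto
    also have "(\<integral>\<^sup>+x. ennreal (exp (l * f x)) * indicator (space \<nu>) x \<partial>\<nu>) = (\<integral>\<^sup>+x. exp (l * f x) \<partial>\<nu>)"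
      by (intro nn_integral_cong) simp
    also have "ennreal (exp (- l * \<epsilon>)) * \<dots> \<le> ennreal (exp (- l * \<epsilon>)) * ennreal (exp (l\<^sup>2 / 8 * \<sigma>\<^sup>2))"
      using laplace_bound[OF f(1) meas' l] f(3) by (intro mult_left_mono) (simp_all add: \<sigma>_def)
    also have "\<dots> = ennreal (exp (- l * \<epsilon> + l\<^sup>2 / 8 * \<sigma>\<^sup>2))"
      by (simp flip: ennreal_mult exp_add)
    also have "- l * \<epsilon> + l\<^sup>2 / 8 * \<sigma>\<^sup>2 = - 2 * (\<epsilon> / \<sigma>)\<^sup>2"
      using \<sigma> by (simp add: l_def field_simps power2_eq_square)
    also have "\<epsilon> / \<sigma> = ?n * \<epsilon> / Delta T b" by (simp add: \<sigma>_def)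
    finally show "measure \<nu> {x \<in> ?X. f x > \<epsilon>} \<le> exp (- 2 * (?n * \<epsilon> / Delta T b)\<^sup>2)"
      by (simp add: emeasure_eq_measure)
  qed
qed

end

section \<open>Families of trees\<close>

lemma lipschitz_markov_concentration:
  fixes \<nu> :: "('v \<Rightarrow> 'h::polish_space) measure"
  assumes diam: "\<And>x y :: 'h. dist x y \<le> 1" and b: "0 \<le> b"
    and T: "finite_rooted_tree T" and \<nu>: "lipschitz_markov_measure T b \<nu>" and \<epsilon>: "0 < \<epsilon>"
  shows "0 \<le> concentration (verts T \<rightarrow>\<^sub>E UNIV) (hamming (verts T)) \<nu> \<epsilon>"
    and "concentration (verts T \<rightarrow>\<^sub>E UNIV) (hamming (verts T)) \<nu> \<epsilon> \<le>
      exp (- 2 * (real (card (verts T)) * \<epsilon> / Delta T b)\<^sup>2)"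
proof -
  obtain \<nu>0 q where q: "markov_measure T \<nu>0 q \<nu>"
      "\<forall>v\<in>verts T - {root T}. \<forall>x y. dbar (q v x) (q v y) \<le> b * dist x y"
    using \<nu> unfolding lipschitz_markov_measure_def by blast
  interpret lipschitz_tree_markov T \<nu>0 q \<nu> b
    by unfold_locales (use T q b diam in auto)
  show "0 \<le> concentration (verts T \<rightarrow>\<^sub>E UNIV) (hamming (verts T)) \<nu> \<epsilon>"
    and "concentration (verts T \<rightarrow>\<^sub>E UNIV) (hamming (verts T)) \<nu> \<epsilon> \<le>
      exp (- 2 * (real (card (verts T)) * \<epsilon> / Delta T b)\<^sup>2)"
    by (rule concentration_bound[OF \<epsilon>])+
qed

theorem corollary2:
  fixes T :: "nat \<Rightarrow> 'v rooted_graph"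
    and \<nu> :: "nat \<Rightarrow> ('v \<Rightarrow> 'h::polish_space) measure"
    and b :: real
  assumes "\<forall>x y :: 'h. dist x y \<le> 1"
    and "0 \<le> b" and "b < 1"
    and "\<forall>k. finite_rooted_tree (T k)"
    and "\<forall>k. lipschitz_markov_measure (T k) b (\<nu> k)"
  shows "((\<lambda>k. Delta (T k) b) \<in> o(\<lambda>k. real (card (verts (T k)))) \<longrightarrow>
            levy_family (\<lambda>k. verts (T k) \<rightarrow>\<^sub>E UNIV) (\<lambda>k. hamming (verts (T k))) \<nu>) \<and>
         (strict_mono (\<lambda>k. card (verts (T k))) \<and>
          (\<lambda>k. Delta (T k) b) \<in> O(\<lambda>k. sqrt (real (card (verts (T k))))) \<longrightarrow>
            normal_levy_family (\<lambda>k. verts (T k)) (\<lambda>k. hamming (verts (T k))) \<nu>)"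
proof -
  define n where "n k = real (card (verts (T k)))" for k
  define \<Delta> where "\<Delta> k = Delta (T k) b" for k
  define C where "C k = concentration (verts (T k) \<rightarrow>\<^sub>E UNIV) (hamming (verts (T k))) (\<nu> k)" for k
  have tree: "rooted_tree (T k)" for k using assms(4) by unfold_locales auto
  have fin: "finite (verts (T k))" and ne: "verts (T k) \<noteq> {}" for k
    using rooted_tree.finite_verts[OF tree] rooted_tree.root_in[OF tree] by auto
  have n: "0 < n k" for k using fin ne by (auto simp: n_def card_gt_0_iff)
  have \<Delta>: "0 < \<Delta> k" for k unfolding \<Delta>_def by (rule rooted_tree.Delta_pos[OF tree assms(2)])
  have C: "0 \<le> C k \<epsilon>" "C k \<epsilon> \<le> exp (- 2 * (n k * \<epsilon> / \<Delta> k)\<^sup>2)" if "0 < \<epsilon>" for k \<epsilon>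
    unfolding C_def n_def \<Delta>_def
    using lipschitz_markov_concentration[of b "T k" "\<nu> k" \<epsilon>] assms that by auto
  have mps: "metric_prob_space (verts (T k) \<rightarrow>\<^sub>E UNIV) (hamming (verts (T k))) (\<nu> k)" for k
    using assms(5) by (intro metric_prob_space_hamming fin ne)
      (auto simp: lipschitz_markov_measure_def markov_measure_def)
  have "levy_family (\<lambda>k. verts (T k) \<rightarrow>\<^sub>E UNIV) (\<lambda>k. hamming (verts (T k))) \<nu>"
    if "\<Delta> \<in> o(n)"
  proof -
    have ratio: "filterlim (\<lambda>k. n k / \<Delta> k) at_top sequentially"
    proof -
      have "(\<lambda>k. \<Delta> k / n k) \<longlonglongrightarrow> 0" by (rule smalloD_tendsto[OF that])
      then have "filterlim (\<lambda>k. inverse (\<Delta> k / n k)) at_top sequentially"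
        using n \<Delta> by (intro filterlim_inverse_at_top) auto
      then show ?thesis by simp
    qed
    have "(\<lambda>k. C k \<epsilon>) \<longlonglongrightarrow> 0" if \<epsilon>: "0 < \<epsilon>" for \<epsilon>
    proof (rule tendsto_sandwich[OF _ _ tendsto_const])
      have "filterlim (\<lambda>k. 2 * \<epsilon>\<^sup>2 * (n k / \<Delta> k)\<^sup>2) at_top sequentially"
        using \<epsilon> by (intro filterlim_tendsto_pos_mult_at_top[OF tendsto_const] filterlim_pow_at_top ratio) auto
      then have "(\<lambda>k. exp (- (2 * \<epsilon>\<^sup>2 * (n k / \<Delta> k)\<^sup>2))) \<longlonglongrightarrow> 0"
        by (intro filterlim_compose[OF exp_at_bot] filterlim_compose[OF filterlim_uminus_at_bot_at_top])
      then show "(\<lambda>k. exp (- 2 * (n k * \<epsilon> / \<Delta> k)\<^sup>2)) \<longlonglongrightarrow> 0"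
        by (simp add: power_mult_distrib power_divide mult_ac)
    qed (use C[OF \<epsilon>] in auto)
    then show ?thesis using mps by (simp add: levy_family_def C_def)
  qed
  moreover have "normal_levy_family (\<lambda>k. verts (T k)) (\<lambda>k. hamming (verts (T k))) \<nu>"
    if mono: "strict_mono (\<lambda>k. card (verts (T k)))" and O: "\<Delta> \<in> O(\<lambda>k. sqrt (n k))"
  proof -
    obtain K where K: "0 < K" "\<And>k. \<Delta> k \<le> K * sqrt (n k)"
    proof -
      \<comment> \<open>The asymptotic bound holds for large \<open>k\<close> only; finitely many \<open>k\<close> are absorbed into the
        constant because \<open>n k > 0\<close>.\<close>
      obtain c where "eventually (\<lambda>k. norm (\<Delta> k) \<le> c * norm (sqrt (n k))) sequentially"
        using O by (rule landau_o.bigE)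
      moreover have s: "0 < sqrt (n k)" for k using n by simp
      ultimately have "Bseq (\<lambda>k. \<Delta> k / sqrt (n k))"
        by (intro BfunI[where K = c])
          (auto elim!: eventually_mono simp: pos_divide_le_eq abs_of_pos simp del: real_sqrt_gt_0_iff)
      then obtain K where K: "0 < K" "\<And>k. norm (\<Delta> k / sqrt (n k)) \<le> K"
        by (auto elim: BseqE)
      have "\<Delta> k \<le> K * sqrt (n k)" for k
      proof -
        have "\<Delta> k / sqrt (n k) \<le> K" using K(2)[of k] unfolding real_norm_def by (rule abs_le_D1)
        then show ?thesis by (simp add: pos_divide_le_eq[OF s])
      qed
      with K(1) show ?thesis by (rule that)
    qed
    have "C k \<epsilon> \<le> 1 * exp (- (2 / K\<^sup>2) * n k * \<epsilon>\<^sup>2)" if \<epsilon>: "0 < \<epsilon>" for k \<epsilon>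
    proof -
      have "(\<Delta> k)\<^sup>2 \<le> (K * sqrt (n k))\<^sup>2" using \<Delta>[of k] K(2)[of k] by (intro power_mono) auto
      also have "\<dots> = K\<^sup>2 * n k" using n[of k] by (simp add: power_mult_distrib)
      finally have "n k * \<epsilon>\<^sup>2 * (\<Delta> k)\<^sup>2 \<le> n k * \<epsilon>\<^sup>2 * (K\<^sup>2 * n k)"
        using n[of k] by (intro mult_left_mono) auto
      then have "n k * \<epsilon>\<^sup>2 / K\<^sup>2 \<le> (n k * \<epsilon> / \<Delta> k)\<^sup>2"
        using n[of k] \<Delta>[of k] K(1) by (simp add: power_mult_distrib power_divide field_simps power2_eq_square)
      then have "exp (- 2 * (n k * \<epsilon> / \<Delta> k)\<^sup>2) \<le> exp (- (2 / K\<^sup>2) * n k * \<epsilon>\<^sup>2)"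
        by simp
      with C(2)[OF \<epsilon>, of k] show ?thesis by linarith
    qed
    then have "\<exists>c1>0. \<exists>c2>0. \<forall>\<epsilon>>0. \<forall>k. C k \<epsilon> \<le> c1 * exp (- c2 * n k * \<epsilon>\<^sup>2)"
      using K(1) by (intro exI[of _ 1] conjI exI[of _ "2 / K\<^sup>2"]) auto
    moreover have "1 \<le> card (verts (T 0))" using fin ne by (simp add: Suc_le_eq card_gt_0_iff)
    ultimately show ?thesis using mps mono by (simp add: normal_levy_family_def C_def n_def)
  qed
  ultimately show ?thesis unfolding \<Delta>_def n_def by blast
qed

end
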